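(* Let $1<n<\infty$ and let $M$ be a $\mathcal{W}_n$-module which, by restriction, is a free $U(\mathfrak{h}_n)$-module of rank $1$. Then $M\cong\Omega(\Lambda_n,a)$ as $\mathcal{W}_n$-modules for some $\Lambda_n\in(\mathbb{C}^* )^n$ and some $a\in\mathbb{C}$.
   Context: $\mathbb{C}^*=\mathbb{C}\setminus\{0\}$. $\mathcal{W}_n=\mathrm{Der}\,\mathbb{C}[t_1^{\pm1},\dots,t_n^{\pm1}]$. Put $\partial_i=t_i\frac{\partial}{\partial t_i}$ and $t^k=t_1^{k_1}\cdots t_n^{k_n}$ for $k\in\mathbb{Z}^n$. Then $\mathcal{W}_n$ has basis $\{t^k\partial_i: 1\le i\le n,\ k\in\mathbb{Z}^n\}$ with bracket $[t^r\partial_i,t^s\partial_j]=s_it^{r+s}\partial_j-r_jt^{r+s}\partial_i$. Its Cartan subalgebra is $\mathfrak{h}_n=\bigoplus_{i=1}^n\mathbb{C}\partial_i$, so $U(\mathfrak{h}_n)=\mathbb{C}[\partial_1,\dots,\partial_n]$. For $\Lambda_n=(\lambda_1,\dots,\lambda_n)\in(\mathbb{C}^* )^n$ and $a\in\mathbb{C}$, $\Omega(\Lambda_n,a)$ is the $\mathcal{W}_n$-module with underlying space $\mathbb{C}[x_1,\dots,x_n]$ and action $$t^k\partial_i\cdot f(x_1,\dots,x_n)=\Lambda_n^k\,(x_i-k_i(a+1))\,f(x_1-k_1,\dots,x_n-k_n),\qquad k\in\mathbb{Z}^n,\ 1\le i\le n,$$ where $\Lambda_n^k=\lambda_1^{k_1}\cdots\lambda_n^{k_n}$.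 *)

theory Defs
  imports "HOL-Analysis.Finite_Cartesian_Product" "HOL-Library.Poly_Mapping"
begin

text \<open>
  Finitely supported functions with the convolution product: exponent vectors in
  \<open>int ^ 'n\<close> give the Laurent polynomial ring, exponent vectors in \<open>nat ^ 'n\<close> the
  polynomial ring, in variables indexed by the finite type \<open>'n\<close>.
\<close>

type_synonym 'n laurent = "(int ^ 'n) \<Rightarrow>\<^sub>0 complex"
type_synonym 'n mpoly = "(nat ^ 'n) \<Rightarrow>\<^sub>0 complex"

definition const :: "complex \<Rightarrow> 'k::zero \<Rightarrow>\<^sub>0 complex" where
  "const c = Poly_Mapping.single 0 c"

definition lmonom :: "int ^ 'n::finite \<Rightarrow> 'n laurent" where
  "lmonom k = Poly_Mapping.single k 1"

definition pvar :: "'n::finite \<Rightarrow> 'n mpoly" where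
  "pvar i = Poly_Mapping.single (axis i 1) 1"


subsection \<open>The Lie algebra of derivations\<close>

definition Witt :: "('n::finite laurent \<Rightarrow> 'n laurent) set" where
  "Witt = {D. (\<forall>f g. D (f + g) = D f + D g) \<and>
              (\<forall>c f. D (const c * f) = const c * D f) \<and>
              (\<forall>f g. D (f * g) = D f * g + f * D g)}"

definition bracket ::
  "('n::finite laurent \<Rightarrow> 'n laurent) \<Rightarrow> ('n laurent \<Rightarrow> 'n laurent) \<Rightarrow> 'n laurent \<Rightarrow> 'n laurent" where
  "bracket D E = (\<lambda>f. D (E f) - E (D f))"

text \<open>The Euler derivation \<open>t\<^sub>i (d/dt\<^sub>i)\<close> multiplies \<open>t^r\<close> by \<open>r\<^sub>i\<close>.\<close>

definition euler :: "'n::finite \<Rightarrow> 'n laurent \<Rightarrow> 'n laurent" where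
  "euler i = Poly_Mapping.mapp (\<lambda>r c. of_int (r $ i) * c)"

definition witt_basis :: "int ^ 'n \<Rightarrow> 'n::finite \<Rightarrow> 'n laurent \<Rightarrow> 'n laurent" where
  "witt_basis k i = (\<lambda>f. lmonom k * euler i f)"


subsection \<open>Modules\<close>

text \<open>The values of \<open>act\<close> outside \<open>Witt\<close> are irrelevant.\<close>

locale witt_module = vector_space smul
  for smul :: "complex \<Rightarrow> 'm::ab_group_add \<Rightarrow> 'm" +
  fixes act :: "('n::finite laurent \<Rightarrow> 'n laurent) \<Rightarrow> 'm \<Rightarrow> 'm"
  assumes act_add_right: "D \<in> Witt \<Longrightarrow> act D (u + v) = act D u + act D v"
    and act_scale_right: "D \<in> Witt \<Longrightarrow> act D (smul c v) = smul c (act D v)"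
    and act_add_left: "D \<in> Witt \<Longrightarrow> E \<in> Witt \<Longrightarrow> act (\<lambda>f. D f + E f) v = act D v + act E v"
    and act_scale_left: "D \<in> Witt \<Longrightarrow> act (\<lambda>f. const c * D f) v = smul c (act D v)"
    and act_bracket: "D \<in> Witt \<Longrightarrow> E \<in> Witt \<Longrightarrow>
      act (bracket D E) v = act D (act E v) - act E (act D v)"

definition witt_module_iso ::
  "(complex \<Rightarrow> 'm::ab_group_add \<Rightarrow> 'm) \<Rightarrow> (('n::finite laurent \<Rightarrow> 'n laurent) \<Rightarrow> 'm \<Rightarrow> 'm) \<Rightarrow>
   (complex \<Rightarrow> 'k::ab_group_add \<Rightarrow> 'k) \<Rightarrow> (('n laurent \<Rightarrow> 'n laurent) \<Rightarrow> 'k \<Rightarrow> 'k) \<Rightarrow> bool" where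
  "witt_module_iso smul act smul' act' \<longleftrightarrow>
    (\<exists>\<phi>. Vector_Spaces.linear smul smul' \<phi> \<and> bij \<phi> \<and>
         (\<forall>D\<in>Witt. \<forall>v. \<phi> (act D v) = act' D (\<phi> v)))"

text \<open>
  The Cartan subalgebra is spanned by the commuting elements \<open>euler i\<close>, so its
  enveloping algebra is the polynomial ring in these; \<open>cartan_act smul act p v\<close> is the
  result of substituting the operators \<open>act (euler i)\<close> for the variables of \<open>p\<close> and
  applying the resulting operator to \<open>v\<close>. The order of the fold is immaterial because
  these operators commute on a module.
\<close>

definition cartan_monom ::
  "(('n::finite laurent \<Rightarrow> 'n laurent) \<Rightarrow> 'm \<Rightarrow> 'm) \<Rightarrow> nat ^ 'n \<Rightarrow> 'm \<Rightarrow> 'm" where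
  "cartan_monom act \<alpha> v = Finite_Set.fold (\<lambda>i. act (euler i) ^^ (\<alpha> $ i)) v UNIV"

definition cartan_act ::
  "(complex \<Rightarrow> 'm::ab_group_add \<Rightarrow> 'm) \<Rightarrow> (('n::finite laurent \<Rightarrow> 'n laurent) \<Rightarrow> 'm \<Rightarrow> 'm) \<Rightarrow>
   'n mpoly \<Rightarrow> 'm \<Rightarrow> 'm" where
  "cartan_act smul act p v =
    (\<Sum>\<alpha>\<in>Poly_Mapping.keys p. smul (Poly_Mapping.lookup p \<alpha>) (cartan_monom act \<alpha> v))"

definition free_module_of_rank ::
  "('r::comm_ring_1 \<Rightarrow> 'm::ab_group_add \<Rightarrow> 'm) \<Rightarrow> nat \<Rightarrow> bool" where
  "free_module_of_rank smult r \<longleftrightarrow> module smult \<and>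
    (\<exists>B. finite B \<and> card B = r \<and> \<not> module.dependent smult B \<and> module.span smult B = UNIV)"


subsection \<open>The modules \<open>\<Omega>(\<Lambda>, a)\<close>\<close>

text \<open>\<open>shift k f\<close> is \<open>f(x - k)\<close>.\<close>

definition shift :: "int ^ 'n \<Rightarrow> 'n::finite mpoly \<Rightarrow> 'n mpoly" where
  "shift k f = (\<Sum>\<alpha>\<in>Poly_Mapping.keys f. const (Poly_Mapping.lookup f \<alpha>) *
                  (\<Prod>i\<in>UNIV. (pvar i - const (of_int (k $ i))) ^ (\<alpha> $ i)))"

definition omega_basis ::
  "complex ^ 'n \<Rightarrow> complex \<Rightarrow> int ^ 'n \<Rightarrow> 'n::finite \<Rightarrow> 'n mpoly \<Rightarrow> 'n mpoly" where
  "omega_basis \<Lambda> a k i f =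
    const (\<Prod>j\<in>UNIV. (\<Lambda> $ j) powi (k $ j)) *
      (pvar i - const (of_int (k $ i) * (a + 1))) * shift k f"

text \<open>
  A derivation \<open>D\<close> is the sum over \<open>i\<close> of \<open>witt_coeff D i\<close> times \<open>euler i\<close>, so its
  coordinate at the basis element \<open>witt_basis k i\<close> is the coefficient of \<open>t^k\<close> in
  \<open>witt_coeff D i\<close>. The action given on the basis is extended linearly.
\<close>

definition witt_coeff :: "('n::finite laurent \<Rightarrow> 'n laurent) \<Rightarrow> 'n \<Rightarrow> 'n laurent" where
  "witt_coeff D i = lmonom (- axis i 1) * D (lmonom (axis i 1))"

definition omega_act ::
  "complex ^ 'n \<Rightarrow> complex \<Rightarrow> ('n::finite laurent \<Rightarrow> 'n laurent) \<Rightarrow> 'n mpoly \<Rightarrow> 'n mpoly" where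
  "omega_act \<Lambda> a D f =
    (\<Sum>i\<in>UNIV. \<Sum>k\<in>Poly_Mapping.keys (witt_coeff D i).
       const (Poly_Mapping.lookup (witt_coeff D i) k) * omega_basis \<Lambda> a k i f)"


subsection \<open>Consistency of the definitions\<close>

lemma poly_mapping_add_induct [case_names single add]:
  fixes f :: "'k \<Rightarrow>\<^sub>0 'c::comm_monoid_add"
  assumes "\<And>k c. P (Poly_Mapping.single k c)" "\<And>f g. P f \<Longrightarrow> P g \<Longrightarrow> P (f + g)"
  shows "P f"
proof -
  have "P (\<Sum>k\<in>A. Poly_Mapping.single k (Poly_Mapping.lookup f k))" if "finite A" for A
    using that
  proof induction
    case empty
    then show ?case using assms(1)[of _ 0] by simp
  qed (simp add: assms)
  moreover have "f = (\<Sum>k\<in>Poly_Mapping.keys f. Poly_Mapping.single k (Poly_Mapping.lookup f k))"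
    by (rule poly_mapping_eqI) (simp add: lookup_sum lookup_single when_def in_keys_iff)
  ultimately show ?thesis by (metis finite_keys)
qed

lemma const_mult_single: "const c * Poly_Mapping.single k d = Poly_Mapping.single (k :: 'k::monoid_add) (c * d)"
  by (simp add: const_def mult_single)

lemma lookup_const_mult: "Poly_Mapping.lookup (const c * f) (k :: 'k::monoid_add) = c * Poly_Mapping.lookup f k"
  by (induction f rule: poly_mapping_add_induct)
     (auto simp: const_mult_single lookup_single when_def distrib_left lookup_add)

lemma lookup_euler: "Poly_Mapping.lookup (euler i f) r = of_int (r $ i) * Poly_Mapping.lookup f r"
  by (auto simp: euler_def lookup_mapp when_def in_keys_iff)

lemma euler_single: "euler i (Poly_Mapping.single r c) = Poly_Mapping.single r (of_int (r $ i) * c)"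
  by (rule poly_mapping_eqI) (auto simp: lookup_euler lookup_single when_def)

lemma euler_add: "euler i (f + g) = euler i f + euler i g"
  by (rule poly_mapping_eqI) (simp add: lookup_euler lookup_add distrib_left)

lemma euler_const_mult: "euler i (const c * f) = const c * euler i f"
  by (rule poly_mapping_eqI) (simp add: lookup_euler lookup_const_mult)

lemma euler_mult: "euler i (f * g) = euler i f * g + f * euler i g"
proof (induction f rule: poly_mapping_add_induct)
  case (single k c)
  show ?case
    by (induction g rule: poly_mapping_add_induct)
       (simp_all add: euler_single euler_add mult_single distrib_left distrib_right
          flip: single_add add: algebra_simps)
qed (simp add: euler_add distrib_right)

lemma witt_basis_in_Witt: "witt_basis k i \<in> Witt"
  unfolding Witt_def witt_basis_def
  by (auto simp only: mem_Collect_eq euler_add euler_const_mult) (simp_all add: euler_mult algebra_simps)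

lemma euler_in_Witt: "euler i \<in> Witt"
  unfolding Witt_def
  by (auto simp only: mem_Collect_eq euler_add euler_const_mult) (simp_all add: euler_mult)

lemma witt_basis_0: "witt_basis 0 i = euler i"
  by (simp add: witt_basis_def lmonom_def fun_eq_iff)

lemma lmonom_mult: "lmonom k * lmonom l = lmonom (k + l)"
  by (simp add: lmonom_def mult_single)

lemma bracket_witt_basis:
  "bracket (witt_basis r i) (witt_basis s j) =
    (\<lambda>f. const (of_int (s $ i)) * witt_basis (r + s) j f - const (of_int (r $ j)) * witt_basis (r + s) i f)"
proof
  fix f :: "'a laurent"
  have e: "euler i (lmonom k) = const (of_int (k $ i)) * lmonom k" for i and k :: "int ^ 'a"
    by (simp add: lmonom_def euler_single const_mult_single)
  have c: "euler i (euler j f) = euler j (euler i f)"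
    by (rule poly_mapping_eqI) (simp add: lookup_euler)
  show "bracket (witt_basis r i) (witt_basis s j) f =
    const (of_int (s $ i)) * witt_basis (r + s) j f - const (of_int (r $ j)) * witt_basis (r + s) i f"
    by (simp add: bracket_def witt_basis_def euler_mult e c flip: lmonom_mult add: algebra_simps)
qed

lemma Witt_expand:
  assumes "D \<in> Witt"
  shows "D f = (\<Sum>i\<in>UNIV. witt_coeff D i * euler i f)"
proof -
  have add: "D (f + g) = D f + D g" and cm: "D (const c * f) = const c * D f"
    and mult: "D (f * g) = D f * g + f * D g" for f g c
    using assms by (auto simp: Witt_def)
  have inv: "lmonom k * lmonom (- k) = 1" for k :: "int ^ 'a"
    by (simp add: lmonom_mult) (simp add: lmonom_def)
  define \<phi> where "\<phi> k = lmonom (- k) * D (lmonom k)" for k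
  have \<phi>_add: "\<phi> (k + l) = \<phi> k + \<phi> l" for k l
  proof -
    have "\<phi> (k + l) = lmonom (- k) * lmonom (- l) * (D (lmonom k) * lmonom l + lmonom k * D (lmonom l))"
      unfolding \<phi>_def lmonom_mult[symmetric, of k l] mult by (simp add: lmonom_mult)
    also have "\<dots> = \<phi> k * (lmonom l * lmonom (- l)) + \<phi> l * (lmonom k * lmonom (- k))"
      by (simp add: \<phi>_def algebra_simps)
    finally show ?thesis by (simp add: inv)
  qed
  interpret \<phi>: additive \<phi> by standard (rule \<phi>_add)
  have ax: "\<phi> (axis i n) = of_int n * witt_coeff D i" for i n
  proof (induction n rule: int_induct[of _ 0])
    case base
    have "axis i (0::int) = 0" by (simp add: vec_eq_iff axis_def)
    then show ?case by (simp only: \<phi>.zero) simp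
  next
    case (step1 n)
    have "axis i (n + 1) = axis i n + axis i 1" by (simp add: vec_eq_iff axis_def)
    with step1 show ?case by (simp add: \<phi>_add algebra_simps) (simp add: \<phi>_def witt_coeff_def)
  next
    case (step2 n)
    have eq: "axis i (n - 1) = axis i n - axis i 1" by (simp add: vec_eq_iff axis_def)
    have "\<phi> (axis i (n - 1)) = \<phi> (axis i n) - \<phi> (axis i 1)" by (subst eq) (rule \<phi>.diff)
    also have "\<phi> (axis i 1) = witt_coeff D i" by (simp only: \<phi>_def witt_coeff_def)
    finally show ?case by (simp only: step2.IH of_int_diff of_int_1 left_diff_distrib mult_1_left)
  qed
  have mon: "D (lmonom k) = (\<Sum>i\<in>UNIV. witt_coeff D i * euler i (lmonom k))" for k
  proof -
    have k: "(\<Sum>i\<in>UNIV. axis i (k $ i)) = k" by (simp add: vec_eq_iff axis_def)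
    have "\<phi> (\<Sum>i\<in>UNIV. axis i (k $ i)) = (\<Sum>i\<in>UNIV. of_int (k $ i) * witt_coeff D i)"
      unfolding \<phi>.sum ax ..
    then have \<phi>k: "\<phi> k = (\<Sum>i\<in>UNIV. of_int (k $ i) * witt_coeff D i)"
      unfolding k .
    have "D (lmonom k) = lmonom k * lmonom (- k) * D (lmonom k)"
      unfolding inv by (rule mult_1_left[symmetric])
    also have "\<dots> = lmonom k * \<phi> k"
      unfolding \<phi>_def by (rule mult.assoc)
    also have "\<dots> = (\<Sum>i\<in>UNIV. witt_coeff D i * (of_int (k $ i) * lmonom k))"
      unfolding \<phi>k sum_distrib_left by (simp only: mult_ac)
    also have "\<dots> = (\<Sum>i\<in>UNIV. witt_coeff D i * euler i (lmonom k))"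
      by (simp add: lmonom_def euler_single mult_single flip: single_of_int)
    finally show ?thesis .
  qed
  show ?thesis
  proof (induction f rule: poly_mapping_add_induct)
    case (single k c)
    have s: "Poly_Mapping.single k c = const c * lmonom k"
      by (simp add: lmonom_def const_mult_single)
    show ?case by (simp add: s cm mon euler_const_mult sum_distrib_left mult_ac)
  qed (simp add: add euler_add distrib_left sum.distrib)
qed

lemma omega_act_witt_basis: "omega_act \<Lambda> a (witt_basis k i) f = omega_basis \<Lambda> a k i f"
proof -
  have "witt_coeff (witt_basis k i) j = (if j = i then lmonom k else 0)" for j
    by (simp add: witt_coeff_def witt_basis_def lmonom_def euler_single mult_single axis_def)
  then have "omega_act \<Lambda> a (witt_basis k i) f =
     (\<Sum>j\<in>UNIV. if j = i then omega_basis \<Lambda> a k i f else 0)"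
    unfolding omega_act_def
    by (intro sum.cong) (auto simp: lmonom_def const_def)
  then show ?thesis by simp
qed

context witt_module
begin

lemma act_euler_commute: "act (euler i) (act (euler j) v) = act (euler j) (act (euler i) v)"
proof -
  have "bracket (euler i) (euler j) = (\<lambda>f. const 0 * euler i f)"
    unfolding bracket_def
    by (rule ext, rule poly_mapping_eqI) (simp add: lookup_euler lookup_minus const_def)
  then show ?thesis
    using act_bracket[OF euler_in_Witt euler_in_Witt, of i j v] act_scale_left[OF euler_in_Witt, of 0 i v]
    by simp
qed

lemma funpow_act_euler_commute:
  "(act (euler i) ^^ m) ((act (euler j) ^^ n) v) = (act (euler j) ^^ n) ((act (euler i) ^^ m) v)"
proof -
  have "act (euler i) ((act (euler j) ^^ n) v) = (act (euler j) ^^ n) (act (euler i) v)" for v i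
    by (induction n) (simp_all, metis act_euler_commute)
  then show ?thesis by (induction m) simp_all
qed

lemma fold_euler_insert:
  assumes "finite S" "i \<notin> S"
  shows "Finite_Set.fold (\<lambda>i. act (euler i) ^^ (\<alpha> $ i)) v (insert i S) =
    (act (euler i) ^^ (\<alpha> $ i)) (Finite_Set.fold (\<lambda>i. act (euler i) ^^ (\<alpha> $ i)) v S)"
proof -
  interpret comp_fun_commute "\<lambda>i. act (euler i) ^^ (\<alpha> $ i)"
    by standard (auto simp: fun_eq_iff funpow_act_euler_commute)
  show ?thesis using assms by simp
qed

lemma linear_cartan_monom:
  "cartan_monom act \<alpha> (u + v) = cartan_monom act \<alpha> u + cartan_monom act \<alpha> v"
  "cartan_monom act \<alpha> (smul c v) = smul c (cartan_monom act \<alpha> v)"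
proof -
  have p: "(act (euler i) ^^ n) (u + v) = (act (euler i) ^^ n) u + (act (euler i) ^^ n) v"
    "(act (euler i) ^^ n) (smul c v) = smul c ((act (euler i) ^^ n) v)" for i n u v
    by (induction n) (simp_all add: act_add_right act_scale_right euler_in_Witt)
  have "Finite_Set.fold (\<lambda>i. act (euler i) ^^ (\<alpha> $ i)) (u + v) S =
      Finite_Set.fold (\<lambda>i. act (euler i) ^^ (\<alpha> $ i)) u S + Finite_Set.fold (\<lambda>i. act (euler i) ^^ (\<alpha> $ i)) v S
    \<and> Finite_Set.fold (\<lambda>i. act (euler i) ^^ (\<alpha> $ i)) (smul c v) S =
      smul c (Finite_Set.fold (\<lambda>i. act (euler i) ^^ (\<alpha> $ i)) v S)" if "finite S" for S
    using that by induction (simp_all add: fold_euler_insert p)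
  then show "cartan_monom act \<alpha> (u + v) = cartan_monom act \<alpha> u + cartan_monom act \<alpha> v"
    "cartan_monom act \<alpha> (smul c v) = smul c (cartan_monom act \<alpha> v)"
    by (simp_all add: cartan_monom_def)
qed

lemma cartan_monom_add: "cartan_monom act (\<alpha> + \<beta>) v = cartan_monom act \<alpha> (cartan_monom act \<beta> v)"
proof -
  define F where "F \<alpha> v S = Finite_Set.fold (\<lambda>i. act (euler i) ^^ (\<alpha> $ i)) v S" for \<alpha> v S
  have F_empty: "F \<alpha> v {} = v" for \<alpha> v
    by (simp add: F_def)
  have F_insert: "F \<alpha> v (insert i S) = (act (euler i) ^^ (\<alpha> $ i)) (F \<alpha> v S)"
    if "finite S" "i \<notin> S" for \<alpha> v i S
    unfolding F_def by (rule fold_euler_insert[OF that])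
  have c: "(act (euler i) ^^ n) (F \<alpha> w S) = F \<alpha> ((act (euler i) ^^ n) w) S" if "finite S" for S i n w
    using that
    by induction (simp_all add: F_empty F_insert, metis funpow_act_euler_commute)
  have "F (\<alpha> + \<beta>) v S = F \<alpha> (F \<beta> v S) S" if "finite S" for S
    using that by induction (simp_all add: F_empty F_insert funpow_add c)
  then show ?thesis by (simp add: cartan_monom_def F_def)
qed

lemma cartan_act_superset:
  assumes "finite A" "Poly_Mapping.keys p \<subseteq> A"
  shows "cartan_act smul act p v = (\<Sum>\<alpha>\<in>A. smul (Poly_Mapping.lookup p \<alpha>) (cartan_monom act \<alpha> v))"
  unfolding cartan_act_def using assms
  by (intro sum.mono_neutral_left) (auto simp: in_keys_iff)

lemma cartan_act_single: "cartan_act smul act (Poly_Mapping.single \<alpha> c) v = smul c (cartan_monom act \<alpha> v)"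
  by (subst cartan_act_superset[of "{\<alpha>}"]) auto

lemma cartan_act_add: "cartan_act smul act (p + q) v = cartan_act smul act p v + cartan_act smul act q v"
proof -
  let ?A = "Poly_Mapping.keys p \<union> Poly_Mapping.keys q"
  have "Poly_Mapping.keys (p + q) \<subseteq> ?A" by (rule Poly_Mapping.keys_add)
  then show ?thesis
    by (simp add: cartan_act_superset[of ?A] lookup_add scale_left_distrib sum.distrib)
qed

lemma module_cartan_act: "module (cartan_act smul act)"
proof
  show right: "cartan_act smul act p (u + v) = cartan_act smul act p u + cartan_act smul act p v" for p u v
    by (simp add: cartan_act_def linear_cartan_monom scale_right_distrib sum.distrib)
  show "cartan_act smul act (p + q) v = cartan_act smul act p v + cartan_act smul act q v" for p q v
    by (rule cartan_act_add)
  show "cartan_act smul act p (cartan_act smul act q v) = cartan_act smul act (p * q) v" for p q v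
  proof (induction p rule: poly_mapping_add_induct)
    case (single \<alpha> c)
    show ?case
      by (induction q rule: poly_mapping_add_induct)
         (simp_all add: cartan_act_single mult_single linear_cartan_monom cartan_monom_add
            cartan_act_add right distrib_left)
  qed (simp add: cartan_act_add distrib_right)
  have id: "finite S \<Longrightarrow> Finite_Set.fold (\<lambda>i. act (euler i) ^^ ((0::nat ^ 'n) $ i)) v S = v" for v S
    by (induction S rule: finite_induct) (simp, subst fold_euler_insert, simp_all add: id_def)
  show "cartan_act smul act 1 v = v" for v
    using id[of UNIV v]
    by (simp add: cartan_act_single cartan_monom_def flip: single_one)
qed

end

end

theory Submission
  imports Defs "HOL-Computational_Algebra.Polynomial"
begin

text \<open>
  A free generator of the module over the enveloping algebra of the Cartan subalgebra
  identifies the module with \<open>\<complex>[x\<^sub>1, \<dots>, x\<^sub>n]\<close>, where \<open>\<partial>\<^sub>i\<close> multiplies by \<open>x\<^sub>i\<close>. The relation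
  \<open>[\<partial>\<^sub>i, t\<^sup>k\<partial>\<^sub>j] = k\<^sub>i t\<^sup>k\<partial>\<^sub>j\<close> then shows that \<open>t\<^sup>k\<partial>\<^sub>j\<close> acts by
  \<open>f(x) \<mapsto> g\<^sub>k\<^sub>,\<^sub>j(x) f(x - k)\<close> for certain polynomials \<open>g\<^sub>k\<^sub>,\<^sub>j\<close> (\<open>pact_shift\<close>), and the
  theorem becomes the solution of a functional equation for these (locale \<open>witt_symbol\<close>).
  Write \<open>g\<^sub>k(u) = \<Sum>\<^sub>j u\<^sub>j g\<^sub>k\<^sub>,\<^sub>j\<close> for a complex vector \<open>u\<close>, and \<open>u\<cdot>x\<close> for the bilinear pairing.

  If \<open>u\<cdot>k = 1\<close>, the weights \<open>m k\<close> and the direction \<open>u\<close> give, along each line with direction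
  \<open>k\<close>, a solution of the equation in one variable. There the relation between weights
  \<open>m\<close> and \<open>- m\<close> determines a product of two polynomials up to a constant, and it is
  quadratic. For \<open>m = 1\<close> both factors are linear, the other possible degrees being excluded by
  the weight \<open>2\<close>. So \<open>g\<^sub>k(u) = c (u\<cdot>x - b(x))\<close> on each line (\<open>form_on_line\<close>). Here \<open>c\<close> is a
  polynomial without zeros, hence constant, and linearity in \<open>u\<close> together with one more bracket
  yields \<open>g\<^sub>k(u) = \<lambda>\<^sub>k (u\<cdot>x - (u\<cdot>k) b\<^sub>k(x))\<close> for every \<open>u\<close>, with \<open>b\<^sub>k\<close> invariant under
  translation by \<open>k\<close> (\<open>weight_form\<close>).

  It remains to compare different weights, which is possible because \<open>n > 1\<close>. For linearly
  independent \<open>r\<close>, \<open>s\<close> there are directions \<open>u\<close>, \<open>v\<close> dual to them, and the brackets in these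
  directions give \<open>\<lambda>\<^sub>r\<^sub>+\<^sub>s = \<lambda>\<^sub>r \<lambda>\<^sub>s\<close> and \<open>b\<^sub>r = b\<^sub>r\<^sub>+\<^sub>s = b\<^sub>s\<close>, and that \<open>b\<^sub>s\<close> is invariant under
  translation by \<open>r\<close> (\<open>dual_pair_bracket\<close>, \<open>dual_pair_invariant\<close>). Hence all \<open>b\<^sub>k\<close> with
  \<open>k \<noteq> 0\<close> are one and the same constant \<open>\<beta>\<close>, and \<open>\<lambda>\<close> is a character of \<open>\<int>\<^sup>n\<close>, that is,
  \<open>\<lambda>\<^sub>k = \<Lambda>\<^sup>k\<close>. This is the action on \<open>\<Omega>(\<Lambda>, \<beta> - 1)\<close>.
\<close>

section \<open>Functions that are polynomial along every line\<close>

definition cvec :: "int ^ 'n::finite \<Rightarrow> complex ^ 'n" where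
  "cvec k = (\<chi> i. of_int (k $ i))"

definition pairing :: "complex ^ 'n::finite \<Rightarrow> complex ^ 'n \<Rightarrow> complex" (infixl "\<bullet>\<bullet>" 70) where
  "u \<bullet>\<bullet> x = (\<Sum>i\<in>UNIV. u $ i * x $ i)"

text \<open>
  Polynomial functions of several variables only enter through their restrictions to
  complex lines, where the theory of univariate polynomials applies.
\<close>

definition line_poly :: "(complex ^ 'n::finite \<Rightarrow> complex) \<Rightarrow> bool" where
  "line_poly f \<longleftrightarrow> (\<forall>x v. \<exists>p. \<forall>t. f (x + t *s v) = poly p t)"

lemma cvec_simps [simp]:
  "cvec 0 = 0" "cvec (k + l) = cvec k + cvec l" "cvec (- k) = - cvec k"
  "cvec (k - l) = cvec k - cvec l" "cvec (m *s k) = of_int m *s cvec k" "cvec k $ i = of_int (k $ i)"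
  by (simp_all add: cvec_def vec_eq_iff)

lemma pairing_simps [simp]:
  "u \<bullet>\<bullet> 0 = 0" "u \<bullet>\<bullet> (x + y) = u \<bullet>\<bullet> x + u \<bullet>\<bullet> y" "u \<bullet>\<bullet> (x - y) = u \<bullet>\<bullet> x - u \<bullet>\<bullet> y"
  "u \<bullet>\<bullet> (- x) = - (u \<bullet>\<bullet> x)" "u \<bullet>\<bullet> (c *s x) = c * (u \<bullet>\<bullet> x)"
  "0 \<bullet>\<bullet> x = 0" "(u + v) \<bullet>\<bullet> x = u \<bullet>\<bullet> x + v \<bullet>\<bullet> x" "(u - v) \<bullet>\<bullet> x = u \<bullet>\<bullet> x - v \<bullet>\<bullet> x"
  "(- u) \<bullet>\<bullet> x = - (u \<bullet>\<bullet> x)" "(c *s u) \<bullet>\<bullet> x = c * (u \<bullet>\<bullet> x)"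
  by (simp_all add: pairing_def algebra_simps sum.distrib sum_subtractf sum_negf sum_distrib_left)

lemma pairing_axis [simp]: "axis i c \<bullet>\<bullet> x = c * x $ i"
proof -
  have "axis i c \<bullet>\<bullet> x = (\<Sum>j\<in>UNIV. if j = i then c * x $ i else 0)"
    unfolding pairing_def by (intro sum.cong) (auto simp: axis_def)
  then show ?thesis by simp
qed

lemma line_poly_const: "line_poly (\<lambda>x. c)"
  unfolding line_poly_def by (metis poly_pCons poly_0 mult_zero_right add.right_neutral)

lemma line_poly_pairing: "line_poly ((\<bullet>\<bullet>) u)"
  unfolding line_poly_def
proof (intro allI)
  fix x v
  show "\<exists>p. \<forall>t. u \<bullet>\<bullet> (x + t *s v) = poly p t"
    by (rule exI[of _ "[:u \<bullet>\<bullet> x, u \<bullet>\<bullet> v:]"]) simp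
qed

lemma line_poly_add: "line_poly f \<Longrightarrow> line_poly h \<Longrightarrow> line_poly (\<lambda>x. f x + h x)"
  unfolding line_poly_def by (metis poly_add)

lemma line_poly_mult: "line_poly f \<Longrightarrow> line_poly h \<Longrightarrow> line_poly (\<lambda>x. f x * h x)"
  unfolding line_poly_def by (metis poly_mult)

lemma line_poly_diff: "line_poly f \<Longrightarrow> line_poly h \<Longrightarrow> line_poly (\<lambda>x. f x - h x)"
  unfolding line_poly_def by (metis poly_diff)

lemma line_poly_sum:
  assumes "\<And>i. i \<in> I \<Longrightarrow> line_poly (f i)"
  shows "line_poly (\<lambda>x. \<Sum>i\<in>I. f i x)"
  using assms by (induction I rule: infinite_finite_induct) (simp_all add: line_poly_const line_poly_add)

lemma line_poly_prod:
  assumes "\<And>i. i \<in> I \<Longrightarrow> line_poly (f i)"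
  shows "line_poly (\<lambda>x. \<Prod>i\<in>I. f i x)"
  using assms by (induction I rule: infinite_finite_induct) (simp_all add: line_poly_const line_poly_mult)

lemma line_poly_power: "line_poly f \<Longrightarrow> line_poly (\<lambda>x. f x ^ n)"
  by (induction n) (simp_all add: line_poly_const line_poly_mult)

lemma line_poly_translate:
  assumes "line_poly f"
  shows "line_poly (\<lambda>x. f (x + a))"
  unfolding line_poly_def
proof (intro allI)
  fix x v
  obtain p where "\<forall>t. f (x + a + t *s v) = poly p t"
    using assms unfolding line_poly_def by blast
  then show "\<exists>p. \<forall>t. f (x + t *s v + a) = poly p t"
    by (auto simp: add_ac)
qed

lemma poly_ext: "(\<And>t. poly p t = poly q t) \<Longrightarrow> p = q" for p q :: "complex poly"
  by (simp add: fun_eq_iff flip: poly_eq_poly_eq_iff)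

lemma poly_periodic_const:
  fixes p :: "complex poly"
  assumes "m \<noteq> 0" "\<And>t. poly p (t + m) = poly p t"
  shows "p = [:poly p 0:]"
proof (rule ccontr)
  assume ne: "p \<noteq> [:poly p 0:]"
  let ?q = "p - [:poly p 0:]"
  have "poly p (of_nat n * m) = poly p 0" for n
    using assms(2)[of "of_nat _ * m"] by (induction n) (simp_all add: algebra_simps)
  then have "range (\<lambda>n. of_nat n * m) \<subseteq> {t. poly ?q t = 0}" by auto
  moreover have "finite {t. poly ?q t = 0}" using ne by (intro poly_roots_finite) auto
  moreover have "inj (\<lambda>n. of_nat n * m)" using assms(1) by (auto simp: inj_def)
  ultimately show False using finite_subset range_inj_infinite by metis
qed

text \<open>
  A polynomial without zeros is constant; on the line joining two points this is the
  fact that units of \<open>complex poly\<close> have degree \<open>0\<close>.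
\<close>

lemma line_poly_unit_const:
  assumes "line_poly f" "line_poly h" "\<And>x. f x * h x = 1"
  shows "f x = f y"
proof -
  obtain p q where p: "\<And>t. f (x + t *s (y - x)) = poly p t" and q: "\<And>t. h (x + t *s (y - x)) = poly q t"
    using assms(1,2) unfolding line_poly_def by meson
  have "p * q = 1"
    by (rule poly_ext) (simp add: assms(3) flip: p q)
  then have "degree p = 0"
    by (metis degree_1 degree_mult_eq add_eq_0_iff_both_eq_0 mult_eq_0_iff zero_neq_one)
  then obtain c where "p = [:c:]" by (rule degree_eq_zeroE)
  then show ?thesis using p[of 0] p[of 1] by simp
qed

lemma line_poly_periodic:
  assumes "line_poly f" "\<And>x. f (x + v) = f x"
  shows "f (x + t *s v) = f x"
proof -
  obtain p where p: "\<And>t. f (x + t *s v) = poly p t"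
    using assms(1) unfolding line_poly_def by meson
  have "poly p (t + 1) = poly p t" for t
    using assms(2)[of "x + t *s v"] by (simp add: vector_sadd_rdistrib add.assoc flip: p)
  then have "p = [:poly p 0:]" by (intro poly_periodic_const[of 1]) simp_all
  then have "poly p t = poly p 0" by (metis poly_pCons poly_0 mult_zero_right add.right_neutral)
  then show ?thesis by (simp flip: p)
qed

section \<open>The functional equation in one variable\<close>

text \<open>
  In one variable the relation of \<open>t\<^sup>m\<partial>\<close> and \<open>t\<^sup>-\<^sup>m\<partial>\<close> says that \<open>F(x) = H(x) G(x + m)\<close>
  satisfies \<open>F(x) - F(x - m) = 2mx\<close>. The particular solution \<open>x\<^sup>2 + mx\<close> differs from \<open>F\<close> by
  an \<open>m\<close>-periodic polynomial, that is, by a constant.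
\<close>

lemma witt_line_product:
  fixes G H :: "complex poly"
  assumes "m \<noteq> 0"
    and eq: "\<And>t. poly G t * poly H (t - m) - poly H t * poly G (t + m) = - 2 * m * t"
  shows "\<exists>c. H * pcompose G [:m, 1:] = [:c, m, 1:]"
proof -
  let ?q = "H * pcompose G [:m, 1:] - [:0, m, 1:]"
  have "?q = [:poly ?q 0:]"
  proof (rule poly_periodic_const)
    fix t
    show "poly ?q (t + m) = poly ?q t"
      using eq[of "t + m"] by (simp add: poly_pcompose algebra_simps)
  qed fact
  then obtain c where "?q = [:c:]" by metis
  then have "H * pcompose G [:m, 1:] = [:c:] + [:0, m, 1:]" by (metis diff_add_cancel)
  then show ?thesis by auto
qed

lemma degree_2_eq:
  fixes p :: "complex poly"
  assumes "degree p \<le> 2" obtains a b c where "p = [:a, b, c:]"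
proof
  show "p = [:coeff p 0, coeff p 1, coeff p 2:]"
  proof (rule poly_eqI)
    fix n
    show "coeff p n = coeff [:coeff p 0, coeff p 1, coeff p 2:] n"
      using assms coeff_eq_0[of p n]
      by (auto simp: coeff_pCons numeral_2_eq_2 split: nat.split)
  qed
qed

text \<open>
  The case of a single variable: \<open>t\<^sup>m\<partial>\<close> acts on \<open>f\<close> by \<open>P m\<close> times the translate
  \<open>f(t - m)\<close>.
\<close>

locale witt_line =
  fixes P :: "int \<Rightarrow> complex poly"
  assumes P_0: "P 0 = [:0, 1:]"
    and rel: "poly (P m) t * poly (P l) (t - of_int m) - poly (P l) t * poly (P m) (t - of_int l)
      = of_int (l - m) * poly (P (m + l)) t"
begin

lemma product:
  assumes "m \<noteq> 0" shows "\<exists>c. P (- m) * pcompose (P m) [:of_int m, 1:] = [:c, of_int m, 1:]"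
  using rel[of m _ "- m"] assms by (intro witt_line_product) (auto simp: P_0)

lemma degree_sum:
  assumes "m \<noteq> 0" shows "degree (P (- m)) + degree (P m) = 2"
proof -
  obtain c where c: "P (- m) * pcompose (P m) [:of_int m, 1:] = [:c, of_int m, 1:]"
    using product[OF assms] by blast
  then have "P (- m) \<noteq> 0" "pcompose (P m) [:of_int m, 1:] \<noteq> 0" by auto
  then have "degree (P (- m)) + degree (pcompose (P m) [:of_int m, 1:]) = degree [:c, of_int m, 1:]"
    by (simp add: degree_mult_eq flip: c)
  then show ?thesis by (simp add: degree_pcompose)
qed

text \<open>
  The product formula leaves the degrees \<open>(1, 1)\<close>, \<open>(0, 2)\<close> and \<open>(2, 0)\<close> for
  \<open>(P (- 1), P 1)\<close>. If \<open>P (- 1)\<close> were a constant, the bracket of weights \<open>2\<close> and \<open>- 1\<close>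
  would make \<open>P 1\<close> a multiple of the difference \<open>P 2 (t) - P 2 (t + 1)\<close>. Since \<open>P 2\<close> is at
  most quadratic by the same product formula, that difference is at most linear, whereas
  \<open>P 1\<close> would be quadratic.
\<close>

lemma degree_minus_1: "degree (P (- 1)) \<noteq> 0"
proof
  assume d: "degree (P (- 1)) = 0"
  then obtain h where h: "P (- 1) = [:h:]" by (rule degree_eq_zeroE)
  have "degree (P 2) \<le> 2" using degree_sum[of 2] by simp
  then obtain a b c where q: "P 2 = [:a, b, c:]" by (rule degree_2_eq)
  have "poly (P 1) t = poly [:h * (b + c) / 3, 2 * h * c / 3:] t" for t
    using rel[of 2 t "- 1"] by (simp add: h q algebra_simps) algebra
  then have "P 1 = [:h * (b + c) / 3, 2 * h * c / 3:]" by (rule poly_ext)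
  then have "degree (P 1) \<le> 1" by simp
  then show False using degree_sum[of 1] d by simp
qed

end

text \<open>
  The automorphism \<open>t \<mapsto> t\<^sup>-\<^sup>1\<close> of the Witt algebra interchanges the weights \<open>1\<close> and
  \<open>- 1\<close>, so that the degrees \<open>(2, 0)\<close> are excluded together with \<open>(0, 2)\<close>.
\<close>

lemma (in witt_line) witt_line_reflect: "witt_line (\<lambda>m. - pcompose (P (- m)) [:0, - 1:])"
proof
  show "- pcompose (P (- 0)) [:0, - 1:] = [:0, 1:]"
    by (simp add: P_0 pcompose_pCons)
  fix m l :: int and t :: complex
  show "poly (- pcompose (P (- m)) [:0, - 1:]) t * poly (- pcompose (P (- l)) [:0, - 1:]) (t - of_int m) -
    poly (- pcompose (P (- l)) [:0, - 1:]) t * poly (- pcompose (P (- m)) [:0, - 1:]) (t - of_int l) =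
    of_int (l - m) * poly (- pcompose (P (- (m + l))) [:0, - 1:]) t"
    using rel[of "- m" "- t" "- l"] by (simp add: poly_pcompose algebra_simps)
qed

lemma (in witt_line) form_pm1:
  obtains c b where "c \<noteq> 0" "P 1 = [:- c * b, c:]" "P (- 1) = [:b / c, 1 / c:]"
proof -
  interpret R: witt_line "\<lambda>m. - pcompose (P (- m)) [:0, - 1:]" by (rule witt_line_reflect)
  have "degree (P 1) \<noteq> 0"
    using R.degree_minus_1 by (simp add: degree_pcompose)
  then have "degree (P 1) = 1" "degree (P (- 1)) = 1"
    using degree_minus_1 degree_sum[of 1] by auto
  then obtain p c q d where pq: "P 1 = [:p, c:]" "P (- 1) = [:q, d:]"
    by (metis degree1_coeffs)
  obtain k where "P (- 1) * pcompose (P 1) [:1, 1:] = [:k, 1, 1:]"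
    using product[of 1] by auto
  then have dc: "d * c = 1" and sum: "q * c + d * p + d * c = 1"
    by (auto simp: pq pcompose_pCons algebra_simps)
  then have "q * c + d * p = 0" by simp
  moreover have c: "c \<noteq> 0" using dc by auto
  moreover have d: "d = 1 / c" using dc c by (simp add: field_simps)
  ultimately have q: "q = (- p / c) / c"
    by (simp add: field_simps add_eq_0_iff2)
  from pq c d q show ?thesis by (intro that[of c "- p / c"]) auto
qed

section \<open>The functional equation at a single weight\<close>

text \<open>
  \<open>g k u\<close> stands for the polynomial to which \<open>\<Sum>\<^sub>i u\<^sub>i t\<^sup>k\<partial>\<^sub>i\<close> sends the generator \<open>1\<close>. The
  weight relation forces this operator to be multiplication by \<open>g k u\<close> after translation by
  \<open>k\<close>, and \<open>g_rel\<close> is the bracket relation. Complex directions \<open>u\<close> are admitted, rather than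
  the unit vectors only, because the arguments below choose \<open>u\<close> orthogonal or dual to given
  weights.
\<close>

locale witt_symbol =
  fixes g :: "int ^ 'n::finite \<Rightarrow> complex ^ 'n \<Rightarrow> complex ^ 'n \<Rightarrow> complex"
  assumes g_add: "g k (u + v) x = g k u x + g k v x"
    and g_scale: "g k (c *s u) x = c * g k u x"
    and g_poly: "line_poly (g k u)"
    and g_0: "g 0 u x = u \<bullet>\<bullet> x"
    and g_rel: "g r u x * g s v (x - cvec r) - g s v x * g r u (x - cvec s)
      = (u \<bullet>\<bullet> cvec s) * g (r + s) v x - (v \<bullet>\<bullet> cvec r) * g (r + s) u x"
begin

text \<open>
  Along a line with direction \<open>k\<close> the operators of weights \<open>m k\<close> in a direction \<open>u\<close> with
  \<open>u \<bullet>\<bullet> cvec k = 1\<close> satisfy the relations of one variable. The line is parametrised so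
  that \<open>u \<bullet>\<bullet> x\<close> is the parameter.
\<close>

lemma form_on_line:
  assumes uk: "u \<bullet>\<bullet> cvec k = 1"
  obtains c b where "c \<noteq> 0" "\<And>t. g k u (x + t *s cvec k) = c * (t + u \<bullet>\<bullet> x - b)"
    "\<And>t. g (- k) u (x + t *s cvec k) = (t + u \<bullet>\<bullet> x + b) / c"
proof -
  let ?x0 = "x - (u \<bullet>\<bullet> x) *s cvec k"
  have "\<exists>p. \<forall>t. g (m *s k) u (?x0 + t *s cvec k) = poly p t" for m
    using g_poly unfolding line_poly_def by blast
  then obtain P where P: "\<And>m t. g (m *s k) u (?x0 + t *s cvec k) = poly (P m) t"
    by metis
  interpret witt_line P
  proof
    show "P 0 = [:0, 1:]"
      by (rule poly_ext) (simp add: g_0 uk flip: P)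
    fix m l :: int and t :: complex
    have sh: "?x0 + (t - of_int n) *s cvec k = ?x0 + t *s cvec k - cvec (n *s k)" for n
      by (simp add: vec_eq_iff algebra_simps)
    have ml: "(m + l) *s k = m *s k + l *s k"
      by (simp add: vec_eq_iff algebra_simps)
    show "poly (P m) t * poly (P l) (t - of_int m) - poly (P l) t * poly (P m) (t - of_int l)
      = of_int (l - m) * poly (P (m + l)) t"
      unfolding P[symmetric] sh ml g_rel by (simp add: uk algebra_simps)
  qed
  obtain c b where cb: "c \<noteq> 0" "P 1 = [:- c * b, c:]" "P (- 1) = [:b / c, 1 / c:]"
    by (rule form_pm1)
  have sh: "x + t *s cvec k = ?x0 + (t + u \<bullet>\<bullet> x) *s cvec k" for t
    by (simp add: vec_eq_iff algebra_simps)
  have k: "k = 1 *s k" "- k = (- 1) *s k"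
    by (simp_all add: vec_eq_iff)
  show ?thesis
  proof
    show "g k u (x + t *s cvec k) = c * (t + u \<bullet>\<bullet> x - b)" for t
      using P[of 1 "t + u \<bullet>\<bullet> x"] unfolding sh[symmetric] k[symmetric] cb(2)
      by (simp only: poly_pCons poly_0) (simp add: right_diff_distrib distrib_left mult.commute)
    show "g (- k) u (x + t *s cvec k) = (t + u \<bullet>\<bullet> x + b) / c" for t
      using P[of "- 1" "t + u \<bullet>\<bullet> x"] unfolding sh[symmetric] k(2)[symmetric] cb(3)
      by (simp only: poly_pCons poly_0) (simp add: add_divide_distrib)
  qed fact
qed

text \<open>
  The coefficient \<open>c\<close> found on a line does not depend on the line: it is a difference of
  values of \<open>g k u\<close>, and its inverse is one of values of \<open>g (- k) u\<close>, so it is a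
  polynomial function without zeros.
\<close>

lemma transversal_form:
  assumes uk: "u \<bullet>\<bullet> cvec k = 1"
  obtains c b where "c \<noteq> 0" "\<And>x. g k u x = c * (u \<bullet>\<bullet> x - b x)"
    "\<And>x. g (- k) u x = (u \<bullet>\<bullet> x + b x) / c" "\<And>x. b (x + cvec k) = b x"
proof -
  define C where "C x = g k u (x + cvec k) - g k u x" for x
  define b where "b x = u \<bullet>\<bullet> x - g k u x / C x" for x
  have line: "C x \<noteq> 0 \<and> g k u x = C x * (u \<bullet>\<bullet> x - b x) \<and> g (- k) u x = (u \<bullet>\<bullet> x + b x) / C x \<and>
    g k u (x + cvec k) = C x * (1 + u \<bullet>\<bullet> x - b x) \<and> g (- k) u (x + cvec k) = (1 + u \<bullet>\<bullet> x + b x) / C x" for x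
  proof (rule form_on_line[OF uk, of x])
    fix c \<beta>
    assume c: "c \<noteq> 0" and p: "\<And>t. g k u (x + t *s cvec k) = c * (t + u \<bullet>\<bullet> x - \<beta>)"
      and q: "\<And>t. g (- k) u (x + t *s cvec k) = (t + u \<bullet>\<bullet> x + \<beta>) / c"
    have "g k u x = c * (u \<bullet>\<bullet> x - \<beta>)" "g k u (x + cvec k) = c * (1 + u \<bullet>\<bullet> x - \<beta>)"
      using p[of 0] p[of 1] by simp_all
    then have C: "C x = c" unfolding C_def by (simp only:) (simp add: algebra_simps)
    have "b x = \<beta>" using p[of 0] c by (simp add: b_def C)
    then show ?thesis using p[of 0] p[of 1] q[of 0] q[of 1] c by (simp add: C)
  qed
  then have C: "C x \<noteq> 0" for x by blast
  have p0: "g k u x = C x * (u \<bullet>\<bullet> x - b x)" and q0: "g (- k) u x = (u \<bullet>\<bullet> x + b x) / C x"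
    and p1: "g k u (x + cvec k) = C x * (1 + u \<bullet>\<bullet> x - b x)"
    and q1: "g (- k) u (x + cvec k) = (1 + u \<bullet>\<bullet> x + b x) / C x" for x
    using line by blast+
  have const: "C x = C 0" for x
  proof -
    let ?f = "\<lambda>x. g k u (x + cvec k) - g k u x" and ?h = "\<lambda>x. g (- k) u (x + cvec k) - g (- k) u x"
    have lp: "line_poly (\<lambda>x. g k u (x + cvec k) - g k u x)"
      "line_poly (\<lambda>x. g (- k) u (x + cvec k) - g (- k) u x)"
      by (intro line_poly_diff line_poly_translate g_poly)+
    have *: "g k u (x + cvec k) - g k u x = C x" "g (- k) u (x + cvec k) - g (- k) u x = 1 / C x" for x
      unfolding p1 q1 unfolding p0 q0
      by (simp_all add: right_diff_distrib distrib_left diff_divide_distrib add_divide_distrib)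
    have "?f x * ?h x = 1" for x
      unfolding * using C by simp
    then have "?f x = ?f 0" by (rule line_poly_unit_const[OF lp])
    then show "C x = C 0" unfolding * .
  qed
  show ?thesis
  proof
    show "C 0 \<noteq> 0" by (rule C)
    show "g k u x = C 0 * (u \<bullet>\<bullet> x - b x)" "g (- k) u x = (u \<bullet>\<bullet> x + b x) / C 0" for x
      using p0[of x] q0[of x] const[of x] by simp_all
    show "b (x + cvec k) = b x" for x
    proof -
      have "C 0 * (u \<bullet>\<bullet> (x + cvec k) - b (x + cvec k)) = C 0 * (1 + u \<bullet>\<bullet> x - b x)"
        using p0[of "x + cvec k"] p1[of x] const[of x] const[of "x + cvec k"] by auto
      then show ?thesis by (simp add: uk C)
    qed
  qed
qed

text \<open>
  The slope of \<open>g k u\<close> in the direction \<open>k\<close> is linear in \<open>u\<close> and does not vanish where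
  \<open>u \<bullet>\<bullet> cvec k = 1\<close>; hence it is zero whenever \<open>u \<bullet>\<bullet> cvec k = 0\<close>. For such a
  direction \<open>w\<close> the bracket of weight \<open>k\<close> with direction \<open>u\<close> and weight \<open>- k\<close> with direction
  \<open>w\<close> is \<open>- (u \<bullet>\<bullet> cvec k)\<close> times the Euler operator of \<open>w\<close>, and this removes the remaining
  additive term \<open>e\<close>.
\<close>

lemma weight_form:
  assumes "k \<noteq> 0"
  obtains c b where "c \<noteq> 0" "\<And>u x. g k u x = c * (u \<bullet>\<bullet> x - (u \<bullet>\<bullet> cvec k) * b x)"
    "\<And>u x. g (- k) u x = (u \<bullet>\<bullet> x + (u \<bullet>\<bullet> cvec k) * b x) / c" "\<And>x. b (x + cvec k) = b x"
proof -
  obtain i where i: "k $ i \<noteq> 0" using assms by (auto simp: vec_eq_iff)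
  define u0 :: "complex ^ 'n" where "u0 = axis i (1 / of_int (k $ i))"
  have u0: "u0 \<bullet>\<bullet> cvec k = 1" using i by (simp add: u0_def)
  obtain c b where c: "c \<noteq> 0" and p: "\<And>x. g k u0 x = c * (u0 \<bullet>\<bullet> x - b x)"
    and q: "\<And>x. g (- k) u0 x = (u0 \<bullet>\<bullet> x + b x) / c" and b: "\<And>x. b (x + cvec k) = b x"
    by (rule transversal_form[OF u0]) (rule that)
  have w: "g k w x = c * (w \<bullet>\<bullet> x) \<and> g (- k) w x = (w \<bullet>\<bullet> x) / c" if w: "w \<bullet>\<bullet> cvec k = 0" for w x
  proof -
    have u0w: "(u0 + w) \<bullet>\<bullet> cvec k = 1" by (simp add: u0 w)
    obtain c' b' where c': "c' \<noteq> 0" and p': "\<And>x. g k (u0 + w) x = c' * ((u0 + w) \<bullet>\<bullet> x - b' x)"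
      and q': "\<And>x. g (- k) (u0 + w) x = ((u0 + w) \<bullet>\<bullet> x + b' x) / c'" and b': "\<And>x. b' (x + cvec k) = b' x"
      by (rule transversal_form[OF u0w]) (rule that)
    have slope: "g k w (x + cvec k) - g k w x = c' - c" for x
    proof -
      have *: "g k w y = g k (u0 + w) y - g k u0 y" for y by (simp add: g_add)
      show ?thesis unfolding * p' p b b' by (simp add: u0 w) (simp add: algebra_simps)
    qed
    have cc: "c' = c"
    proof (rule ccontr)
      assume ne: "c' \<noteq> c"
      \<comment> \<open>A direction dual to \<open>k\<close> in which the slope vanishes.\<close>
      define v where "v = u0 + (c / (c - c')) *s w"
      have v: "v \<bullet>\<bullet> cvec k = 1" by (simp add: v_def u0 w)
      obtain c'' b'' where c'': "c'' \<noteq> 0" and p'': "\<And>x. g k v x = c'' * (v \<bullet>\<bullet> x - b'' x)"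
        and "\<And>x. g (- k) v x = (v \<bullet>\<bullet> x + b'' x) / c''" and b'': "\<And>x. b'' (x + cvec k) = b'' x"
        by (rule transversal_form[OF v]) (rule that)
      have "c'' = g k v (0 + cvec k) - g k v 0"
        unfolding p'' b'' by (simp add: v) (simp add: algebra_simps)
      also have "\<dots> = (g k u0 (0 + cvec k) - g k u0 0) + c / (c - c') * (g k w (0 + cvec k) - g k w 0)"
        unfolding v_def g_add g_scale by (simp only: algebra_simps)
      also have "g k u0 (0 + cvec k) - g k u0 0 = c"
        unfolding p b by (simp add: u0) (simp add: algebra_simps)
      also have "c + c / (c - c') * (g k w (0 + cvec k) - g k w 0) = 0"
      proof -
        have "c / (c - c') * (c' - c) = - c" using ne nonzero_mult_divide_mult_cancel_right[of "c - c'" c 1]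
          by (simp add: divide_eq_eq) (simp add: algebra_simps)
        then show ?thesis unfolding slope by simp
      qed
      finally show False using c'' by simp
    qed
    define e where "e x = b' x - b x" for x
    have pw: "g k w x = c * (w \<bullet>\<bullet> x - e x)" and qw: "g (- k) w x = (w \<bullet>\<bullet> x + e x) / c" for x
    proof -
      have "g k w x = g k (u0 + w) x - g k u0 x" "g (- k) w x = g (- k) (u0 + w) x - g (- k) u0 x"
        by (simp_all add: g_add)
      then show "g k w x = c * (w \<bullet>\<bullet> x - e x)" "g (- k) w x = (w \<bullet>\<bullet> x + e x) / c"
        unfolding p' q' p q cc e_def by (simp_all add: right_diff_distrib distrib_left diff_divide_distrib add_divide_distrib)
    qed
    have e: "e (x + cvec k) = e x" for x
      by (simp add: e_def b b')
    have em: "e (x - cvec k) = e x" for x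
      using e[of "x - cvec k"] by simp
    have "e x = 0" for x
    proof -
      have "c * (u0 \<bullet>\<bullet> x - b x) * ((w \<bullet>\<bullet> x + e x) / c)
        - (w \<bullet>\<bullet> x + e x) / c * (c * (u0 \<bullet>\<bullet> x + 1 - b x)) = - (w \<bullet>\<bullet> x)"
        using g_rel[of k u0 x "- k" w] unfolding p qw cvec_simps diff_minus_eq_add b em by (simp add: g_0 u0 w)
      then have "(u0 \<bullet>\<bullet> x - b x) * (w \<bullet>\<bullet> x + e x)
        - (w \<bullet>\<bullet> x + e x) * (u0 \<bullet>\<bullet> x + 1 - b x) = - (w \<bullet>\<bullet> x)"
        using c by simp
      then show ?thesis by (simp add: algebra_simps)
    qed
    then show ?thesis by (simp add: pw qw)
  qed
  show ?thesis
  proof (rule that)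
    show "c \<noteq> 0" "b (x + cvec k) = b x" for x by (fact c, fact b)
    fix u x
    define w where "w = u - (u \<bullet>\<bullet> cvec k) *s u0"
    have wk: "w \<bullet>\<bullet> cvec k = 0" by (simp add: w_def u0)
    have u: "u = (u \<bullet>\<bullet> cvec k) *s u0 + w" by (simp add: w_def)
    have ux: "(u \<bullet>\<bullet> cvec k) * (u0 \<bullet>\<bullet> x) + w \<bullet>\<bullet> x = u \<bullet>\<bullet> x"
      by (simp add: w_def)
    have "g k u x = (u \<bullet>\<bullet> cvec k) * g k u0 x + g k w x"
      by (subst u) (simp only: g_add g_scale)
    also have "\<dots> = c * ((u \<bullet>\<bullet> cvec k) * (u0 \<bullet>\<bullet> x) + w \<bullet>\<bullet> x - (u \<bullet>\<bullet> cvec k) * b x)"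
      unfolding p conjunct1[OF w[OF wk]] by (simp only: algebra_simps)
    finally show "g k u x = c * (u \<bullet>\<bullet> x - (u \<bullet>\<bullet> cvec k) * b x)" unfolding ux .
    have "g (- k) u x = (u \<bullet>\<bullet> cvec k) * g (- k) u0 x + g (- k) w x"
      by (subst u) (simp only: g_add g_scale)
    also have "\<dots> = ((u \<bullet>\<bullet> cvec k) * (u0 \<bullet>\<bullet> x) + w \<bullet>\<bullet> x + (u \<bullet>\<bullet> cvec k) * b x) / c"
      unfolding q conjunct2[OF w[OF wk]] by (simp add: add_divide_distrib distrib_left)
    finally show "g (- k) u x = (u \<bullet>\<bullet> x + (u \<bullet>\<bullet> cvec k) * b x) / c" unfolding ux .
  qed
qed

end

section \<open>Comparison of different weights\<close>

text \<open>
  The normal form at all weights at once. At \<open>k = 0\<close> it reads \<open>g 0 u x = u \<bullet>\<bullet> x\<close> and does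
  not determine \<open>b 0\<close>.
\<close>

locale witt_weights = witt_symbol g for g :: "int ^ 'n::finite \<Rightarrow> complex ^ 'n \<Rightarrow> complex ^ 'n \<Rightarrow> complex" +
  fixes lam :: "int ^ 'n \<Rightarrow> complex" and b :: "int ^ 'n \<Rightarrow> complex ^ 'n \<Rightarrow> complex"
  assumes lam_nz: "lam k \<noteq> 0"
    and g_form: "g k u x = lam k * (u \<bullet>\<bullet> x - (u \<bullet>\<bullet> cvec k) * b k x)"
    and lam_minus: "lam (- k) = 1 / lam k"
    and b_poly: "line_poly (b k)"
    and b_periodic: "b k (x + cvec k) = b k x"

lemma (in witt_symbol) witt_weights_exist: "\<exists>lam b. witt_weights g lam b"
proof -
  define Q where "Q k c \<beta> \<longleftrightarrow> c \<noteq> 0 \<and> (\<forall>u x. g k u x = c * (u \<bullet>\<bullet> x - (u \<bullet>\<bullet> cvec k) * \<beta> x)) \<and>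
    (\<forall>u x. g (- k) u x = (u \<bullet>\<bullet> x + (u \<bullet>\<bullet> cvec k) * \<beta> x) / c) \<and>
    line_poly \<beta> \<and> (\<forall>x. \<beta> (x + cvec k) = \<beta> x)" for k c \<beta>
  have "\<exists>L. Q k (fst L) (snd L)" for k
  proof (cases "k = 0")
    case True
    then have "Q k 1 (\<lambda>x. 0)" by (simp add: Q_def g_0 line_poly_const)
    then show ?thesis by (intro exI[of _ "(_, _)"]) simp
  next
    case False
    then obtain i where i: "k $ i \<noteq> 0" by (auto simp: vec_eq_iff)
    define u :: "complex ^ 'n" where "u = axis i (1 / of_int (k $ i))"
    have u: "u \<bullet>\<bullet> cvec k = 1" using i by (simp add: u_def)
    obtain c \<beta> where *: "c \<noteq> 0" "\<And>u x. g k u x = c * (u \<bullet>\<bullet> x - (u \<bullet>\<bullet> cvec k) * \<beta> x)"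
      "\<And>u x. g (- k) u x = (u \<bullet>\<bullet> x + (u \<bullet>\<bullet> cvec k) * \<beta> x) / c" "\<And>x. \<beta> (x + cvec k) = \<beta> x"
      by (rule weight_form[OF False]) (rule that)
    have "\<beta> = (\<lambda>x. u \<bullet>\<bullet> x - (1 / c) * g k u x)"
      using *(1) by (simp add: *(2) u fun_eq_iff)
    moreover have "line_poly (\<lambda>x. u \<bullet>\<bullet> x - (1 / c) * g k u x)"
      by (intro line_poly_diff line_poly_mult line_poly_const line_poly_pairing g_poly)
    ultimately have "line_poly \<beta>" by simp
    then have "Q k c \<beta>" unfolding Q_def by (intro conjI allI *)
    then show ?thesis by (intro exI[of _ "(_, _)"]) simp
  qed
  then obtain L where L: "\<And>k. Q k (fst (L k)) (snd (L k))"
    using choice[of "\<lambda>k L. Q k (fst L) (snd L)"] by blast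
  define lam b where "lam k = fst (L k)" and "b k = snd (L k)" for k
  have Q: "Q k (lam k) (b k)" for k using L by (simp add: lam_def b_def)
  have nz: "lam k \<noteq> 0" and form: "g k u x = lam k * (u \<bullet>\<bullet> x - (u \<bullet>\<bullet> cvec k) * b k x)"
    and minus: "g (- k) u x = (u \<bullet>\<bullet> x + (u \<bullet>\<bullet> cvec k) * b k x) / lam k"
    and poly: "line_poly (b k)" and per: "b k (x + cvec k) = b k x" for k u x
    using Q[of k] unfolding Q_def by blast+
  have inv: "lam (- k) = 1 / lam k" for k
  proof (cases "k = 0")
    case True
    define u :: "complex ^ 'n" where "u = axis undefined 1"
    define x :: "complex ^ 'n" where "x = axis undefined 1"
    have ux: "u \<bullet>\<bullet> x = 1" by (simp add: u_def x_def)
    have "lam 0 = 1" using form[of 0 u x] by (simp add: g_0 ux)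
    then show ?thesis using True by simp
  next
    case False
    then obtain i where i: "k $ i \<noteq> 0" by (auto simp: vec_eq_iff)
    define u :: "complex ^ 'n" where "u = axis i (1 / of_int (k $ i))"
    have u: "u \<bullet>\<bullet> cvec k = 1" using i by (simp add: u_def)
    have "b (- k) (cvec k) = b (- k) 0" using per[of "- k" "cvec k"] by simp
    moreover have "b k (cvec k) = b k 0" using per[of k 0] by simp
    ultimately have "g (- k) u (cvec k) - g (- k) u 0 = lam (- k)"
      using form[of "- k" u "cvec k"] form[of "- k" u 0] by (simp add: u algebra_simps)
    moreover have "g (- k) u (cvec k) - g (- k) u 0 = 1 / lam k"
      using minus[of k u "cvec k"] minus[of k u 0] \<open>b k (cvec k) = b k 0\<close>
      by (simp add: u add_divide_distrib)
    ultimately show ?thesis by simp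
  qed
  have "witt_weights g lam b"
    by unfold_locales (fact nz form inv poly per)+
  then show ?thesis by blast
qed

context witt_weights
begin

text \<open>
  The bracket of weights \<open>r\<close> and \<open>s\<close> in one direction \<open>u\<close> with \<open>u \<bullet>\<bullet> cvec r = 0\<close> expresses
  \<open>b (r + s)\<close> by \<open>b s\<close> and the difference \<open>G\<close> of \<open>b s\<close> along \<open>r\<close>. Translation along
  \<open>r + s\<close> changes the side with \<open>b (r + s)\<close> by the constant \<open>c\<close> only, and the resulting
  identity is polynomial in \<open>u \<bullet>\<bullet> x\<close>, which varies along \<open>s\<close>: its two coefficients give the
  multiplicativity of \<open>lam\<close> and the invariance of \<open>G\<close> along \<open>r\<close>.
\<close>

lemma dual_pair_bracket:
  assumes ur: "u \<bullet>\<bullet> cvec r = 0" and us: "u \<bullet>\<bullet> cvec s = 1"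
  shows "lam (r + s) = lam r * lam s"
    and "b (r + s) x = b s x - (u \<bullet>\<bullet> x) * (b s x - b s (x - cvec r))"
    and "b s (x + cvec r) - b s x = b s x - b s (x - cvec r)"
proof -
  define G where "G x = b s x - b s (x - cvec r)" for x
  define c where "c = lam (r + s) / (lam r * lam s)"
  have E: "c * (u \<bullet>\<bullet> x - b (r + s) x) = u \<bullet>\<bullet> x - b s x + (u \<bullet>\<bullet> x) * G x" for x
  proof -
    have "lam r * lam s * ((u \<bullet>\<bullet> x) * (u \<bullet>\<bullet> x - b s (x - cvec r)) - (u \<bullet>\<bullet> x - b s x) * (u \<bullet>\<bullet> x - 1))
      = lam (r + s) * (u \<bullet>\<bullet> x - b (r + s) x)"
      using g_rel[of r u x s u] by (simp add: g_form ur us) (simp add: algebra_simps)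
    then have "c * (u \<bullet>\<bullet> x - b (r + s) x)
      = (u \<bullet>\<bullet> x) * (u \<bullet>\<bullet> x - b s (x - cvec r)) - (u \<bullet>\<bullet> x - b s x) * (u \<bullet>\<bullet> x - 1)"
      unfolding c_def using lam_nz[of r] lam_nz[of s] by (simp add: divide_eq_eq mult.commute)
    then show ?thesis by (simp add: G_def algebra_simps)
  qed
  have Gs: "G (x + cvec s) = G x" for x
    using b_periodic[of s "x - cvec r"] by (simp add: G_def b_periodic algebra_simps)
  \<comment> \<open>Compare \<open>E\<close> at \<open>x\<close> and at \<open>x + cvec (r + s)\<close>.\<close>
  have D: "c = 1 + (u \<bullet>\<bullet> x) * (G (x + cvec r) - G x)" for x
  proof -
    have 1: "b (r + s) (x + cvec r + cvec s) = b (r + s) x"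
      using b_periodic[of "r + s" x] by (simp add: add.assoc)
    have 2: "b s (x + cvec r + cvec s) = b s x + G (x + cvec r)"
      by (simp add: b_periodic G_def)
    have "c * (u \<bullet>\<bullet> x + 1 - b (r + s) x)
      = u \<bullet>\<bullet> x + 1 - (b s x + G (x + cvec r)) + (u \<bullet>\<bullet> x + 1) * G (x + cvec r)"
      using E[of "x + cvec r + cvec s"] unfolding 1 2 Gs by (simp add: ur us)
    with E[of x] show ?thesis by algebra
  qed
  \<comment> \<open>Translating \<open>D\<close> along \<open>s\<close> changes only the factor \<open>u \<bullet>\<bullet> x\<close>, so its cofactor vanishes.\<close>
  have Gr: "G (x + cvec r) = G x" for x
  proof -
    have "G (x + cvec s + cvec r) = G (x + cvec r)"
      using Gs[of "x + cvec r"] by (simp add: add_ac)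
    then have "c = 1 + (u \<bullet>\<bullet> x + 1) * (G (x + cvec r) - G x)"
      using D[of "x + cvec s"] by (simp add: Gs us)
    with D[of x] show ?thesis by algebra
  qed
  then have c: "c = 1" using D[of 0] by simp
  then show "lam (r + s) = lam r * lam s"
    using lam_nz[of r] lam_nz[of s] by (simp add: c_def)
  show "b (r + s) x = b s x - (u \<bullet>\<bullet> x) * (b s x - b s (x - cvec r))"
  proof -
    have "u \<bullet>\<bullet> x - b (r + s) x = u \<bullet>\<bullet> x - b s x + (u \<bullet>\<bullet> x) * G x"
      using E[of x] by (simp only: c mult_1_left)
    then show ?thesis unfolding G_def by algebra
  qed
  show "b s (x + cvec r) - b s x = b s x - b s (x - cvec r)"
    using Gr[of x] by (simp add: G_def)
qed

text \<open>
  With dual directions \<open>u\<close>, \<open>v\<close> the two operators commute. Together with its translates along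
  \<open>r\<close> and \<open>s\<close> this equation forces the differences \<open>S\<close> and \<open>R\<close> of \<open>b s\<close> along \<open>r\<close> and of
  \<open>b r\<close> along \<open>s\<close> to be both \<open>0\<close> or both \<open>- 1\<close>. The second case contradicts the symmetry of
  \<open>b (r + s)\<close> in \<open>r\<close> and \<open>s\<close>.
\<close>

lemma dual_pair_invariant:
  assumes ur: "u \<bullet>\<bullet> cvec r = 0" and us: "u \<bullet>\<bullet> cvec s = 1"
    and vr: "v \<bullet>\<bullet> cvec r = 1" and vs: "v \<bullet>\<bullet> cvec s = 0"
  shows "b s (x + cvec r) = b s x"
proof -
  define S where "S x = b s x - b s (x - cvec r)" for x
  define R where "R x = b r x - b r (x - cvec s)" for x
  \<comment> \<open>Both sides are \<open>b (r + s) x\<close>.\<close>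
  have A: "b s x - (u \<bullet>\<bullet> x) * S x = b r x - (v \<bullet>\<bullet> x) * R x" for x
    using dual_pair_bracket(2)[OF ur us, of x] dual_pair_bracket(2)[OF vs vr, of x]
    by (simp add: S_def R_def add.commute)
  have bs: "b s (x + cvec r) = b s x + S x" and br: "b r (x + cvec s) = b r x + R x" for x
    using dual_pair_bracket(3)[OF ur us, of x] dual_pair_bracket(3)[OF vs vr, of x]
    by (simp_all add: S_def R_def algebra_simps)
  have Sr: "S (x + cvec r) = S x" and Rs: "R (x + cvec s) = R x" for x
    unfolding S_def[of "x + cvec r"] R_def[of "x + cvec s"] by (simp_all only: bs br add_diff_cancel_left' add_diff_cancel_right')
  have Ss: "S (x + cvec s) = S x" for x
    using b_periodic[of s "x - cvec r"] by (simp add: S_def b_periodic algebra_simps)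
  have Rr: "R (x + cvec r) = R x" for x
    using b_periodic[of r "x - cvec s"] by (simp add: R_def b_periodic algebra_simps)
  have B: "(v \<bullet>\<bullet> x - b r x) * S x = (u \<bullet>\<bullet> x - b s x) * R x" for x
  proof -
    have "lam r * lam s * ((v \<bullet>\<bullet> x - b r x) * (u \<bullet>\<bullet> x - b s (x - cvec r))
      - (u \<bullet>\<bullet> x - b s x) * (v \<bullet>\<bullet> x - b r (x - cvec s))) = 0"
      using g_rel[of r v x s u] by (simp add: g_form ur us vr vs)
    then have "(v \<bullet>\<bullet> x - b r x) * (u \<bullet>\<bullet> x - b s (x - cvec r))
      = (u \<bullet>\<bullet> x - b s x) * (v \<bullet>\<bullet> x - b r (x - cvec s))"
      using lam_nz by simp
    then show ?thesis by (simp add: S_def R_def algebra_simps)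
  qed
  have S: "S x = 0" for x
  proof (rule ccontr)
    assume ne: "S x \<noteq> 0"
    have 1: "(v \<bullet>\<bullet> x + 1 - b r x) * S x = (u \<bullet>\<bullet> x - (b s x + S x)) * R x"
      using B[of "x + cvec r"] by (simp add: bs b_periodic Sr Rr ur vr)
    have 2: "(v \<bullet>\<bullet> x - (b r x + R x)) * S x = (u \<bullet>\<bullet> x + 1 - b s x) * R x"
      using B[of "x + cvec s"] by (simp add: br b_periodic Ss Rs us vs)
    have "S x * (R x + 1) = 0" using B[of x] 1 by algebra
    then have R: "R x = - 1" using ne by (simp add: add_eq_0_iff2)
    have "R x * (S x + 1) = 0" using B[of x] 2 by algebra
    then have "S x + 1 = 0" using R by (simp only: mult_eq_0_iff) simp
    then have S: "S x = - 1" by (simp only: eq_neg_iff_add_eq_0)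
    have "b s x + S x - (u \<bullet>\<bullet> x) * S x = b r x - (v \<bullet>\<bullet> x + 1) * R x"
      using A[of "x + cvec r"] by (simp add: bs b_periodic Sr Rr ur vr)
    with A[of x] show False by (simp add: R S algebra_simps)
  qed
  show ?thesis using bs S by simp
qed

end

text \<open>
  Linear independence as a nonvanishing \<open>2 \<times> 2\<close> minor, so that Cramer's rule gives dual
  directions.
\<close>

definition indep :: "int ^ 'n::finite \<Rightarrow> int ^ 'n \<Rightarrow> bool" where
  "indep r s \<longleftrightarrow> (\<exists>i j. r $ i * s $ j \<noteq> r $ j * s $ i)"

lemma indep_dual:
  fixes r s :: "int ^ 'n::finite"
  assumes "indep r s"
  obtains u where "u \<bullet>\<bullet> cvec r = 0" "u \<bullet>\<bullet> cvec s = 1"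
proof -
  obtain i j where "r $ i * s $ j \<noteq> r $ j * s $ i"
    using assms by (auto simp: indep_def)
  define d :: complex where "d = of_int (r $ i * s $ j - r $ j * s $ i)"
  have "d \<noteq> 0" using \<open>r $ i * s $ j \<noteq> r $ j * s $ i\<close> unfolding d_def of_int_eq_0_iff by simp
  show ?thesis
  proof (rule that[of "axis j (of_int (r $ i) / d) - axis i (of_int (r $ j) / d)"])
    show "(axis j (of_int (r $ i) / d) - axis i (of_int (r $ j) / d)) \<bullet>\<bullet> cvec r = 0"
      by simp
    have "(axis j (of_int (r $ i) / d) - axis i (of_int (r $ j) / d)) \<bullet>\<bullet> cvec s = d / d"
      unfolding d_def by (simp flip: diff_divide_distrib)
    then show "(axis j (of_int (r $ i) / d) - axis i (of_int (r $ j) / d)) \<bullet>\<bullet> cvec s = 1"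
      using \<open>d \<noteq> 0\<close> by simp
  qed
qed

lemma indep_sym: "indep r s \<Longrightarrow> indep s r"
  unfolding indep_def by (metis mult.commute)

lemma indep_axis: "k $ i \<noteq> 0 \<Longrightarrow> j \<noteq> i \<Longrightarrow> indep k (axis j 1)" for k :: "int ^ 'n::finite"
  unfolding indep_def by (intro exI[of _ i] exI[of _ j]) (simp add: axis_def)

lemma exists_other:
  assumes "1 < CARD('n)" obtains j :: "'n::finite" where "j \<noteq> i"
proof -
  have "\<exists>j. j \<noteq> i"
  proof (rule ccontr)
    assume "\<not> ?thesis"
    then have "(UNIV :: 'n set) = {i}" by auto
    then show False using assms by (metis card.insert card.empty finite.emptyI empty_iff less_irrefl One_nat_def)
  qed
  then show ?thesis using that by blast
qed

context witt_weights
begin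

lemma indep_weights:
  assumes "indep r s"
  shows "lam (r + s) = lam r * lam s" "b s (x + cvec r) = b s x" "b (r + s) x = b s x"
proof -
  obtain u where u: "u \<bullet>\<bullet> cvec r = 0" "u \<bullet>\<bullet> cvec s = 1" by (rule indep_dual[OF assms])
  obtain v where v: "v \<bullet>\<bullet> cvec s = 0" "v \<bullet>\<bullet> cvec r = 1" by (rule indep_dual[OF indep_sym[OF assms]])
  show inv: "b s (x + cvec r) = b s x" for x by (rule dual_pair_invariant[OF u v(2) v(1)])
  show "lam (r + s) = lam r * lam s" by (rule dual_pair_bracket(1)[OF u])
  show "b (r + s) x = b s x" using dual_pair_bracket(2)[OF u, of x] inv[of "x - cvec r"] by simp
qed

text \<open>
  For weights that are not independent, \<open>r + s\<close> is split as \<open>(r + t) + (s - t)\<close> with a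
  coordinate vector \<open>t\<close> outside their common line, unless \<open>r + s = 0\<close>, where
  \<open>lam_minus\<close> applies.
\<close>

lemma lam_add:
  assumes card: "1 < CARD('n)"
  shows "lam (r + s) = lam r * lam s"
proof -
  have minus: "lam (- k) * lam k = 1" for k using lam_nz[of k] by (simp add: lam_minus)
  have lam_0: "lam 0 = 1"
  proof -
    define u :: "complex ^ 'n" where "u = axis undefined 1"
    define x :: "complex ^ 'n" where "x = axis undefined 1"
    have ux: "u \<bullet>\<bullet> x = 1" by (simp add: u_def x_def)
    show ?thesis using g_form[of 0 u x] by (simp add: g_0 ux)
  qed
  consider "indep r s" | "r = 0" | "s = 0" | "r + s = 0" | "\<not> indep r s" "r \<noteq> 0" "s \<noteq> 0" "r + s \<noteq> 0"
    by blast
  then show ?thesis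
  proof cases
    case 1
    then show ?thesis by (rule indep_weights)
  next
    case 4
    then show ?thesis using minus[of s] lam_0 by (simp add: add_eq_0_iff2)
  next
    case 5
    then have par: "r $ i * s $ j = r $ j * s $ i" for i j by (auto simp: indep_def)
    obtain i where i: "r $ i \<noteq> 0" using 5 by (auto simp: vec_eq_iff)
    obtain l where l: "s $ l \<noteq> 0" using 5 by (auto simp: vec_eq_iff)
    obtain m where m: "r $ m + s $ m \<noteq> 0" using 5 by (auto simp: vec_eq_iff)
    have si: "s $ i \<noteq> 0" using par[of i l] i l by auto
    have "r $ i * (r $ m + s $ m) = r $ m * (r $ i + s $ i)"
      using par[of i m] by (simp add: algebra_simps)
    then have rsi: "r $ i + s $ i \<noteq> 0" using i m by auto
    obtain j where j: "j \<noteq> i" by (rule exists_other[OF card])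
    let ?t = "axis j 1 :: int ^ 'n"
    have rt: "indep r ?t" by (rule indep_axis[OF i j])
    have st: "indep s (- ?t)"
      unfolding indep_def using si j by (intro exI[of _ i] exI[of _ j]) (simp add: axis_def)
    have rst: "indep (r + ?t) (s + - ?t)"
      unfolding indep_def using rsi j par[of i j]
      by (intro exI[of _ i] exI[of _ j]) (simp add: axis_def algebra_simps)
    have "lam (r + s) = lam ((r + ?t) + (s + - ?t))" by simp
    also have "\<dots> = (lam r * lam ?t) * (lam s * lam (- ?t))"
      by (simp only: indep_weights(1)[OF rst] indep_weights(1)[OF rt] indep_weights(1)[OF st])
    also have "\<dots> = lam r * lam s * (lam (- ?t) * lam ?t)" by (simp only: mult_ac)
    finally show ?thesis by (simp add: minus)
  qed (simp_all add: lam_0)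
qed

lemma lam_powi:
  assumes card: "1 < CARD('n)"
  shows "lam k = (\<Prod>j\<in>UNIV. lam (axis j 1) powi (k $ j))"
proof -
  have lam_0: "lam 0 = 1"
    using lam_add[OF card, of 0 0] lam_nz[of 0] by simp
  have ax: "lam (axis j m) = lam (axis j 1) powi m" for j m
  proof (induction m rule: int_induct[of _ 0])
    case base
    have "axis j (0::int) = 0" by (simp add: vec_eq_iff axis_def)
    then show ?case using lam_0 by (simp only:) simp
  next
    case (step1 m)
    have "axis j (m + 1) = axis j m + axis j 1" by (simp add: vec_eq_iff axis_def)
    then show ?case using step1 lam_nz by (simp add: lam_add[OF card] power_int_add)
  next
    case (step2 m)
    have eq: "axis j (m - 1) = axis j m + - axis j 1" by (simp add: vec_eq_iff axis_def)
    have "lam (axis j (m - 1)) = lam (axis j m) * (1 / lam (axis j 1))"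
      by (simp only: eq lam_add[OF card] lam_minus)
    then show ?case using step2 lam_nz[of "axis j 1"] by (simp add: power_int_diff)
  qed
  have "lam (\<Sum>j\<in>J. axis j (k $ j)) = (\<Prod>j\<in>J. lam (axis j 1) powi (k $ j))" if "finite J" for J
    using that
  proof induction
    case (insert j J)
    then show ?case by (simp add: lam_add[OF card] ax[of j "k $ j"])
  qed (simp add: lam_0)
  moreover have "(\<Sum>j\<in>UNIV. axis j (k $ j)) = k" by (simp add: vec_eq_iff axis_def)
  ultimately show ?thesis by (metis finite)
qed

text \<open>
  Translations along coordinate vectors independent of \<open>k\<close> leave \<open>b k\<close> unchanged, and a
  coordinate vector parallel to \<open>k\<close> is covered by \<open>b_periodic\<close>. A function that is polynomial
  along lines and periodic in every coordinate direction is constant.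
\<close>

lemma b_const:
  assumes "k \<noteq> 0"
  shows "b k x = b k 0"
proof -
  have dir: "b k (x + t *s axis i 1) = b k x" for x t i
  proof (cases "indep (axis i 1) k")
    case True
    have ci: "cvec (axis i 1) = axis i 1" by (simp add: vec_eq_iff axis_def)
    show ?thesis
      using indep_weights(2)[OF True] unfolding ci by (rule line_poly_periodic[OF b_poly])
  next
    case False
    have zero: "k $ j = 0" if "j \<noteq> i" for j
      using False that indep_axis[of k j i] indep_sym by auto
    have ki: "k $ i \<noteq> 0"
    proof
      assume "k $ i = 0"
      then have "k $ j = 0" for j using zero[of j] by (cases "j = i") auto
      then show False using assms by (simp add: vec_eq_iff)
    qed
    have cv: "cvec k = of_int (k $ i) *s axis i 1"
      using zero by (auto simp: vec_eq_iff axis_def)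
    have "t *s axis i 1 = (t / of_int (k $ i)) *s cvec k"
      unfolding cv vector_smult_assoc using ki by simp
    then show ?thesis by (simp only: line_poly_periodic[OF b_poly b_periodic])
  qed
  have span: "b k (\<Sum>i\<in>I. (x $ i) *s axis i 1) = b k 0" if "finite I" for I
    using that
  proof induction
    case (insert i I)
    have "(\<Sum>i\<in>insert i I. (x $ i) *s axis i 1) = (\<Sum>i\<in>I. (x $ i) *s axis i 1) + (x $ i) *s axis i 1"
      using insert.hyps by (simp add: add.commute)
    then show ?case using insert.IH by (simp only: dir)
  qed simp
  have x: "(\<Sum>i\<in>UNIV. (x $ i) *s axis i 1) = x"
    by (simp add: vec_eq_iff axis_def if_distrib cong: if_cong)
  show ?thesis using span[OF finite_class.finite_UNIV] unfolding x .
qed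

lemma b_same:
  assumes card: "1 < CARD('n)"
  obtains \<beta> where "\<And>k x. k \<noteq> 0 \<Longrightarrow> b k x = \<beta>"
proof -
  have same: "b r 0 = b s 0" if "indep r s" for r s
    using indep_weights(3)[OF that, of 0] indep_weights(3)[OF indep_sym[OF that], of 0]
    by (simp add: add.commute)
  have ax: "b (axis i 1) 0 = b (axis j 1) 0" for i j
  proof (cases "i = j")
    case False
    then show ?thesis by (intro same indep_axis[of _ i]) (auto simp: axis_def)
  qed simp
  show ?thesis
  proof
    fix k :: "int ^ 'n" and x
    assume k: "k \<noteq> 0"
    then obtain i where i: "k $ i \<noteq> 0" by (auto simp: vec_eq_iff)
    obtain j where "j \<noteq> i" by (rule exists_other[OF card])
    with i have "b k 0 = b (axis j 1) 0" by (intro same indep_axis)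
    then show "b k x = b (axis undefined 1) 0"
      using b_const[OF k, of x] ax[of j undefined] by simp
  qed
qed

end

text \<open>
  The right-hand side is the symbol of \<open>\<Omega>(\<Lambda>, \<beta> - 1)\<close>.
\<close>

theorem (in witt_symbol) witt_symbol_classification:
  assumes card: "1 < CARD('n)"
  obtains \<Lambda> :: "complex ^ 'n" and \<beta> where "\<And>i. \<Lambda> $ i \<noteq> 0"
    "\<And>k u x. g k u x = (\<Prod>j\<in>UNIV. (\<Lambda> $ j) powi (k $ j)) * (u \<bullet>\<bullet> x - (u \<bullet>\<bullet> cvec k) * \<beta>)"
proof -
  obtain lam b where "witt_weights g lam b" using witt_weights_exist by blast
  then interpret witt_weights g lam b .
  obtain \<beta> where \<beta>: "\<And>k x. k \<noteq> 0 \<Longrightarrow> b k x = \<beta>" by (rule b_same[OF card]) (rule that)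
  show ?thesis
  proof (rule that[of "\<chi> j. lam (axis j 1)" \<beta>])
    show "(\<chi> j. lam (axis j 1)) $ i \<noteq> 0" for i by (simp add: lam_nz)
    fix k u x
    have "(u \<bullet>\<bullet> cvec k) * b k x = (u \<bullet>\<bullet> cvec k) * \<beta>"
      by (cases "k = 0") (simp_all add: \<beta>)
    then show "g k u x = (\<Prod>j\<in>UNIV. ((\<chi> j. lam (axis j 1)) $ j) powi (k $ j)) * (u \<bullet>\<bullet> x - (u \<bullet>\<bullet> cvec k) * \<beta>)"
      unfolding g_form by (simp flip: lam_powi[OF card])
  qed
qed

section \<open>Values of polynomials\<close>

definition peval :: "'n::finite mpoly \<Rightarrow> complex ^ 'n \<Rightarrow> complex" where
  "peval p x = (\<Sum>\<alpha>\<in>Poly_Mapping.keys p. Poly_Mapping.lookup p \<alpha> * (\<Prod>i\<in>UNIV. (x $ i) ^ (\<alpha> $ i)))"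

lemma peval_superset:
  assumes "finite A" "Poly_Mapping.keys p \<subseteq> A"
  shows "peval p x = (\<Sum>\<alpha>\<in>A. Poly_Mapping.lookup p \<alpha> * (\<Prod>i\<in>UNIV. (x $ i) ^ (\<alpha> $ i)))"
  unfolding peval_def using assms
  by (intro sum.mono_neutral_left) (auto simp: in_keys_iff)

lemma peval_single: "peval (Poly_Mapping.single \<alpha> c) x = c * (\<Prod>i\<in>UNIV. (x $ i) ^ (\<alpha> $ i))"
  by (subst peval_superset[of "{\<alpha>}"]) auto

lemma peval_add [simp]: "peval (p + q) x = peval p x + peval q x"
proof -
  let ?A = "Poly_Mapping.keys p \<union> Poly_Mapping.keys q"
  have "Poly_Mapping.keys (p + q) \<subseteq> ?A" by (rule Poly_Mapping.keys_add)
  then show ?thesis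
    by (simp add: peval_superset[of ?A] lookup_add distrib_right sum.distrib)
qed

lemma peval_mult [simp]: "peval (p * q) x = peval p x * peval q x"
proof (induction p rule: poly_mapping_add_induct)
  case (single \<alpha> c)
  show ?case
    by (induction q rule: poly_mapping_add_induct)
       (simp_all add: peval_single mult_single distrib_left power_add prod.distrib)
qed (simp add: distrib_right)

lemma peval_const [simp]: "peval (const c) x = c"
  by (simp add: const_def peval_single)

lemma peval_pvar [simp]: "peval (pvar i) x = x $ i"
proof -
  have "peval (pvar i) x = (\<Prod>j\<in>UNIV. if j = i then x $ i else 1)"
    unfolding pvar_def peval_single mult_1_left by (intro prod.cong) (auto simp: axis_def)
  then show ?thesis by simp
qed

lemma peval_0 [simp]: "peval 0 x = 0"
  by (simp add: peval_def)

lemma peval_1 [simp]: "peval 1 x = 1"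
  using peval_const[of 1 x] by (simp add: const_def)

lemma peval_diff [simp]: "peval (p - q) x = peval p x - peval q x"
  using peval_add[of "p - q" q x] by simp

lemma peval_sum [simp]: "peval (\<Sum>a\<in>A. f a) x = (\<Sum>a\<in>A. peval (f a) x)"
  by (induction A rule: infinite_finite_induct) simp_all

lemma peval_prod [simp]: "peval (\<Prod>a\<in>A. f a) x = (\<Prod>a\<in>A. peval (f a) x)"
  by (induction A rule: infinite_finite_induct) simp_all

lemma peval_power [simp]: "peval (p ^ n) x = peval p x ^ n"
  by (induction n) simp_all

lemma peval_shift [simp]: "peval (shift k p) x = peval p (x - cvec k)"
  by (simp add: shift_def peval_def[of p])

lemma line_poly_peval: "line_poly (peval p)"
proof -
  have coord: "line_poly (\<lambda>x. x $ i)" for i :: 'a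
  proof -
    have "(\<lambda>x. x $ i) = (\<bullet>\<bullet>) (axis i 1)" by (simp add: fun_eq_iff)
    then show ?thesis by (simp only: line_poly_pairing)
  qed
  show ?thesis
    unfolding peval_def[abs_def]
    by (intro line_poly_sum line_poly_mult line_poly_const line_poly_prod line_poly_power coord)
qed

text \<open>
  Independence of characters: for monomials \<open>\<alpha>\<close> and \<open>\<beta>\<close> that differ in the exponent of
  \<open>x\<^sub>i\<close>, doubling \<open>x\<^sub>i\<close> and subtracting \<open>2 ^ (\<beta> $ i)\<close> times the original relation removes
  \<open>\<beta>\<close> but multiplies the coefficient of \<open>\<alpha>\<close> by a nonzero number.
\<close>

lemma monomials_independent:
  fixes c :: "nat ^ 'n::finite \<Rightarrow> complex"
  assumes "finite A" "\<And>x. (\<Sum>\<alpha>\<in>A. c \<alpha> * (\<Prod>i\<in>UNIV. (x $ i) ^ (\<alpha> $ i))) = 0" "\<alpha> \<in> A"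
  shows "c \<alpha> = 0"
  using assms
proof (induction A arbitrary: c \<alpha>)
  case (insert \<beta> A)
  let ?m = "\<lambda>\<alpha> x. \<Prod>i\<in>UNIV. ((x :: complex ^ 'n) $ i) ^ (\<alpha> $ i)"
  have rest: "c \<alpha> = 0" if \<alpha>: "\<alpha> \<in> A" for \<alpha>
  proof -
    obtain i where i: "\<alpha> $ i \<noteq> \<beta> $ i" using insert.hyps \<alpha> by (metis vec_eq_iff)
    define y where "y x = (\<chi> j. if j = i then 2 * x $ j else x $ j)" for x :: "complex ^ 'n"
    have m: "?m \<gamma> (y x) = 2 ^ (\<gamma> $ i) * ?m \<gamma> x" for \<gamma> x
    proof -
      have "?m \<gamma> (y x) = (\<Prod>j\<in>UNIV. (if j = i then 2 ^ (\<gamma> $ i) else 1) * (x $ j) ^ (\<gamma> $ j))"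
        by (intro prod.cong) (auto simp: y_def power_mult_distrib)
      then show ?thesis by (simp add: prod.distrib)
    qed
    have "(\<Sum>\<alpha>\<in>A. c \<alpha> * (2 ^ (\<alpha> $ i) - 2 ^ (\<beta> $ i)) * ?m \<alpha> x) = 0" for x
    proof -
      have "(\<Sum>\<alpha>\<in>insert \<beta> A. c \<alpha> * ?m \<alpha> (y x)) - 2 ^ (\<beta> $ i) * (\<Sum>\<alpha>\<in>insert \<beta> A. c \<alpha> * ?m \<alpha> x) = 0"
        by (simp only: insert.prems(1) mult_zero_right diff_zero)
      also have "(\<Sum>\<alpha>\<in>insert \<beta> A. c \<alpha> * ?m \<alpha> (y x)) - 2 ^ (\<beta> $ i) * (\<Sum>\<alpha>\<in>insert \<beta> A. c \<alpha> * ?m \<alpha> x)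
        = (\<Sum>\<alpha>\<in>insert \<beta> A. c \<alpha> * (2 ^ (\<alpha> $ i) - 2 ^ (\<beta> $ i)) * ?m \<alpha> x)"
        unfolding m sum_distrib_left sum_subtractf[symmetric] by (intro sum.cong) (simp_all add: algebra_simps)
      finally show ?thesis using insert.hyps by simp
    qed
    then have "c \<alpha> * (2 ^ (\<alpha> $ i) - 2 ^ (\<beta> $ i)) = 0" using \<alpha> by (rule insert.IH)
    moreover have "(2 :: complex) ^ (\<alpha> $ i) \<noteq> 2 ^ (\<beta> $ i)"
    proof
      assume "(2 :: complex) ^ (\<alpha> $ i) = 2 ^ (\<beta> $ i)"
      then have "norm ((2 :: complex) ^ (\<alpha> $ i)) = norm ((2 :: complex) ^ (\<beta> $ i))" by (simp only:)
      then show False using i by (simp add: norm_power)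
    qed
    ultimately show ?thesis by simp
  qed
  then have "c \<beta> = 0" using insert.prems(1)[of "\<chi> i. 1"] insert.hyps by simp
  with rest insert.prems(2) show ?case by auto
qed simp

lemma peval_inject:
  assumes "\<And>x. peval p x = peval q x"
  shows "p = q"
proof -
  have "Poly_Mapping.lookup (p - q) \<alpha> = 0" for \<alpha>
  proof (cases "\<alpha> \<in> Poly_Mapping.keys (p - q)")
    case True
    have "peval (p - q) x = 0" for x by (simp add: assms)
    then have "(\<Sum>\<alpha>\<in>Poly_Mapping.keys (p - q).
      Poly_Mapping.lookup (p - q) \<alpha> * (\<Prod>i\<in>UNIV. (x $ i) ^ (\<alpha> $ i))) = 0" for x
      by (simp only: peval_def)
    then show ?thesis using True by (rule monomials_independent[OF finite_keys])
  qed (simp add: in_keys_iff)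
  then have "p - q = 0" by (intro poly_mapping_eqI) simp
  then show ?thesis by simp
qed

section \<open>Modules that are free of rank one over the Cartan subalgebra\<close>

lemma const_simps:
  "const 0 = 0" "const 1 = 1" "const (c + d) = const c + const d" "const (c * d) = const c * const d"
  "const (- c) = - const c"
  by (simp_all add: const_def single_add mult_single single_uminus)

lemma Witt_scale: "D \<in> Witt \<Longrightarrow> (\<lambda>f. const c * D f) \<in> Witt"
  unfolding Witt_def by (auto simp: algebra_simps)

lemma Witt_zero: "(\<lambda>f. 0) \<in> Witt"
  unfolding Witt_def by simp

lemma Witt_add: "D \<in> Witt \<Longrightarrow> E \<in> Witt \<Longrightarrow> (\<lambda>f. D f + E f) \<in> Witt"
  unfolding Witt_def by (auto simp: algebra_simps)

lemma Witt_sum: "(\<And>a. a \<in> A \<Longrightarrow> D a \<in> Witt) \<Longrightarrow> (\<lambda>f. \<Sum>a\<in>A. D a f) \<in> Witt"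
  by (induction A rule: infinite_finite_induct) (simp_all add: Witt_zero Witt_add)

lemma Witt_expand_basis:
  assumes "D \<in> Witt"
  shows "D = (\<lambda>f. \<Sum>i\<in>UNIV. \<Sum>k\<in>Poly_Mapping.keys (witt_coeff D i).
    const (Poly_Mapping.lookup (witt_coeff D i) k) * witt_basis k i f)"
proof
  fix f
  have "p = (\<Sum>k\<in>Poly_Mapping.keys p. const (Poly_Mapping.lookup p k) * lmonom k)" for p :: "'a laurent"
    by (rule poly_mapping_eqI)
       (simp add: lookup_sum lookup_const_mult lmonom_def lookup_single when_def in_keys_iff if_distrib cong: if_cong)
  note expand = this
  have "D f = (\<Sum>i\<in>UNIV. witt_coeff D i * euler i f)" by (rule Witt_expand[OF assms])
  also have "\<dots> = (\<Sum>i\<in>UNIV. \<Sum>k\<in>Poly_Mapping.keys (witt_coeff D i).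
    const (Poly_Mapping.lookup (witt_coeff D i) k) * witt_basis k i f)"
  proof (rule sum.cong)
    fix i
    have "witt_coeff D i * euler i f = (\<Sum>k\<in>Poly_Mapping.keys (witt_coeff D i).
      const (Poly_Mapping.lookup (witt_coeff D i) k) * lmonom k) * euler i f"
      by (subst expand) (rule refl)
    then show "witt_coeff D i * euler i f = (\<Sum>k\<in>Poly_Mapping.keys (witt_coeff D i).
      const (Poly_Mapping.lookup (witt_coeff D i) k) * witt_basis k i f)"
      by (simp only: sum_distrib_right witt_basis_def mult.assoc)
  qed simp
  finally show "D f = \<dots>" .
qed

context witt_module
begin

lemma cartan_act_const: "cartan_act smul act (const c) v = smul c v"
proof -
  interpret M: module "cartan_act smul act" by (rule module_cartan_act)
  have "cartan_monom act 0 v = v"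
    using M.scale_one[of v] by (simp add: cartan_act_single flip: single_one)
  then show ?thesis by (simp add: const_def cartan_act_single)
qed

lemma cartan_act_pvar: "cartan_act smul act (pvar i) v = act (euler i) v"
proof -
  let ?e = "axis i 1 :: nat ^ 'n"
  have rest: "Finite_Set.fold (\<lambda>j. act (euler j) ^^ (?e $ j)) v S = v" if "finite S" "i \<notin> S" for S
    using that
  proof induction
    case (insert j S)
    then have "?e $ j = 0" by (auto simp: axis_def)
    with insert show ?case by (subst fold_euler_insert) simp_all
  qed simp
  have "cartan_monom act ?e v = Finite_Set.fold (\<lambda>j. act (euler j) ^^ (?e $ j)) v (insert i (UNIV - {i}))"
    unfolding cartan_monom_def by (simp add: insert_absorb)
  also have "\<dots> = act (euler i) v"
    by (subst fold_euler_insert, simp, simp, subst rest) simp_all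
  finally show ?thesis by (simp add: pvar_def cartan_act_single)
qed

lemma act_sum_left:
  assumes "finite A" "\<And>a. a \<in> A \<Longrightarrow> D a \<in> Witt"
  shows "act (\<lambda>f. \<Sum>a\<in>A. D a f) v = (\<Sum>a\<in>A. act (D a) v)"
  using assms
proof induction
  case empty
  show ?case using act_scale_left[OF Witt_zero, of 0 v] by simp
next
  case (insert a A)
  have "act (\<lambda>f. \<Sum>a\<in>insert a A. D a f) v = act (\<lambda>f. D a f + (\<Sum>a\<in>A. D a f)) v"
    using insert.hyps by simp
  also have "\<dots> = act (D a) v + act (\<lambda>f. \<Sum>a\<in>A. D a f) v"
    by (rule act_add_left) (auto intro!: Witt_sum insert.prems)
  finally show ?case using insert by simp
qed

end

text \<open>
  A free generator \<open>v0\<close> identifies the module with the polynomial ring, and \<open>pact D\<close> is the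
  action of \<open>D\<close> under this identification.
\<close>

locale rank_one_witt_module = witt_module smul act
  for smul :: "complex \<Rightarrow> 'm::ab_group_add \<Rightarrow> 'm"
    and act :: "('n::finite laurent \<Rightarrow> 'n laurent) \<Rightarrow> 'm \<Rightarrow> 'm" +
  fixes v0 :: 'm
  assumes generator: "bij (\<lambda>p. cartan_act smul act p v0)"
begin

interpretation M: module "cartan_act smul act" by (rule module_cartan_act)

definition coord :: "'m \<Rightarrow> 'n mpoly" where
  "coord = inv (\<lambda>p. cartan_act smul act p v0)"

definition pact :: "('n laurent \<Rightarrow> 'n laurent) \<Rightarrow> 'n mpoly \<Rightarrow> 'n mpoly" where
  "pact D p = coord (act D (cartan_act smul act p v0))"

lemma coord_eqI: "cartan_act smul act p v0 = v \<Longrightarrow> coord v = p"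
  unfolding coord_def using generator by (metis bij_inv_eq_iff)

lemma cartan_act_coord: "cartan_act smul act (coord v) v0 = v"
  unfolding coord_def using generator by (metis bij_inv_eq_iff)

lemma coord_add: "coord (u + v) = coord u + coord v"
  by (rule coord_eqI) (simp add: M.scale_left_distrib cartan_act_coord)

lemma coord_diff: "coord (u - v) = coord u - coord v"
  by (rule coord_eqI) (simp add: M.scale_left_diff_distrib cartan_act_coord)

lemma coord_smul: "coord (smul c v) = const c * coord v"
  by (rule coord_eqI) (simp add: cartan_act_coord cartan_act_const flip: M.scale_scale)

lemma coord_sum: "coord (\<Sum>a\<in>A. f a) = (\<Sum>a\<in>A. coord (f a))"
  by (rule coord_eqI) (simp add: M.scale_sum_left cartan_act_coord)

lemma coord_bij: "bij coord"
  unfolding coord_def using generator by (rule bij_imp_bij_inv)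

lemma coord_act: "coord (act D v) = pact D (coord v)"
  by (simp add: pact_def cartan_act_coord)

lemma pact_euler: "pact (euler i) p = pvar i * p"
  unfolding pact_def by (rule coord_eqI) (simp add: cartan_act_pvar flip: M.scale_scale)

lemma pact_add: "D \<in> Witt \<Longrightarrow> pact D (p + q) = pact D p + pact D q"
  by (simp add: pact_def M.scale_left_distrib act_add_right coord_add)

lemma pact_const: "D \<in> Witt \<Longrightarrow> pact D (const c * p) = const c * pact D p"
  by (simp add: pact_def cartan_act_const act_scale_right coord_smul flip: M.scale_scale)

lemma pact_bracket: "D \<in> Witt \<Longrightarrow> E \<in> Witt \<Longrightarrow> pact (bracket D E) p = pact D (pact E p) - pact E (pact D p)"
  by (simp add: pact_def act_bracket coord_diff cartan_act_coord)

lemma pact_bracket_basis: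
  "pact (witt_basis r i) (pact (witt_basis s j) p) - pact (witt_basis s j) (pact (witt_basis r i) p)
    = const (of_int (s $ i)) * pact (witt_basis (r + s) j) p - const (of_int (r $ j)) * pact (witt_basis (r + s) i) p"
proof -
  have "bracket (witt_basis r i) (witt_basis s j) =
    (\<lambda>f. const (of_int (s $ i)) * witt_basis (r + s) j f + const (- of_int (r $ j)) * witt_basis (r + s) i f)"
    unfolding bracket_witt_basis by (simp add: const_simps)
  then have "pact (bracket (witt_basis r i) (witt_basis s j)) p
    = const (of_int (s $ i)) * pact (witt_basis (r + s) j) p + const (- of_int (r $ j)) * pact (witt_basis (r + s) i) p"
    by (simp only: pact_def act_add_left act_scale_left Witt_scale witt_basis_in_Witt coord_add coord_smul)
  then show ?thesis by (simp add: pact_bracket witt_basis_in_Witt const_simps)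
qed

lemma pact_pvar: "pact (witt_basis k j) (pvar i * p) = (pvar i - const (of_int (k $ i))) * pact (witt_basis k j) p"
  using pact_bracket_basis[of 0 i k j p]
  by (simp add: witt_basis_0 pact_euler const_simps algebra_simps)

text \<open>
  By \<open>pact_pvar\<close>, \<open>t\<^sup>k\<partial>\<^sub>j\<close> intertwines multiplication by \<open>x\<^sub>i\<close> with multiplication by
  \<open>x\<^sub>i - k\<^sub>i\<close>. It is therefore determined by the image of \<open>1\<close>.
\<close>

lemma pact_shift: "pact (witt_basis k j) p = shift k p * pact (witt_basis k j) 1"
proof -
  have power: "pact (witt_basis k j) (pvar i ^ n * p) = (pvar i - const (of_int (k $ i))) ^ n * pact (witt_basis k j) p" for i n p
    by (induction n) (simp_all add: pact_pvar mult.assoc)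
  have prod: "pact (witt_basis k j) (\<Prod>i\<in>S. pvar i ^ (\<alpha> $ i))
    = (\<Prod>i\<in>S. (pvar i - const (of_int (k $ i))) ^ (\<alpha> $ i)) * pact (witt_basis k j) 1"
    if "finite S" for S and \<alpha> :: "nat ^ 'n"
    using that by induction (simp_all add: power mult.assoc)
  have monom: "Poly_Mapping.single \<alpha> c = const c * (\<Prod>i\<in>UNIV. pvar i ^ (\<alpha> $ i))" for \<alpha> :: "nat ^ 'n" and c
    by (rule peval_inject) (simp add: peval_single)
  show ?thesis
  proof (induction p rule: poly_mapping_add_induct)
    case (single \<alpha> c)
    have "shift k (Poly_Mapping.single \<alpha> c) = const c * (\<Prod>i\<in>UNIV. (pvar i - const (of_int (k $ i))) ^ (\<alpha> $ i))"
      by (rule peval_inject) (simp add: peval_single)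
    then show ?case
      by (simp add: monom pact_const witt_basis_in_Witt prod mult.assoc)
  next
    case (add p q)
    have "shift k (p + q) = shift k p + shift k q"
      by (rule peval_inject) simp
    with add show ?case by (simp add: pact_add witt_basis_in_Witt distrib_right)
  qed
qed

definition symbol :: "int ^ 'n \<Rightarrow> complex ^ 'n \<Rightarrow> complex ^ 'n \<Rightarrow> complex" where
  "symbol k u x = (\<Sum>i\<in>UNIV. u $ i * peval (pact (witt_basis k i) 1) x)"

lemma symbol_axis: "symbol k (axis i 1) x = peval (pact (witt_basis k i) 1) x"
proof -
  have "symbol k (axis i 1) x = (\<Sum>j\<in>UNIV. if j = i then peval (pact (witt_basis k i) 1) x else 0)"
    unfolding symbol_def by (intro sum.cong) (auto simp: axis_def)
  then show ?thesis by simp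
qed

lemma witt_symbol_symbol: "witt_symbol symbol"
proof
  fix k r s :: "int ^ 'n" and u v x :: "complex ^ 'n" and c
  show "symbol k (u + v) x = symbol k u x + symbol k v x"
    by (simp add: symbol_def distrib_right sum.distrib)
  show "symbol k (c *s u) x = c * symbol k u x"
    by (simp add: symbol_def sum_distrib_left mult.assoc)
  show "line_poly (symbol k u)"
    unfolding symbol_def[abs_def]
    by (intro line_poly_sum line_poly_mult line_poly_const line_poly_peval)
  show "symbol 0 u x = u \<bullet>\<bullet> x"
    by (simp add: symbol_def pairing_def witt_basis_0 pact_euler)
  let ?G = "\<lambda>k i. peval (pact (witt_basis k i) 1)"
  have basis: "?G r i x * ?G s j (x - cvec r) - ?G s j x * ?G r i (x - cvec s)
    = of_int (s $ i) * ?G (r + s) j x - of_int (r $ j) * ?G (r + s) i x" for i j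
  proof -
    have "pact (witt_basis r i) (pact (witt_basis s j) 1) = shift r (pact (witt_basis s j) 1) * pact (witt_basis r i) 1"
      "pact (witt_basis s j) (pact (witt_basis r i) 1) = shift s (pact (witt_basis r i) 1) * pact (witt_basis s j) 1"
      by (rule pact_shift)+
    then have "peval (shift r (pact (witt_basis s j) 1) * pact (witt_basis r i) 1
        - shift s (pact (witt_basis r i) 1) * pact (witt_basis s j) 1) x
      = peval (const (of_int (s $ i)) * pact (witt_basis (r + s) j) 1 - const (of_int (r $ j)) * pact (witt_basis (r + s) i) 1) x"
      using pact_bracket_basis[of r i s j 1] by simp
    then show ?thesis by (simp add: mult.commute)
  qed
  have "symbol r u x * symbol s v (x - cvec r) - symbol s v x * symbol r u (x - cvec s)
    = (\<Sum>i\<in>UNIV. \<Sum>j\<in>UNIV. u $ i * v $ j * (?G r i x * ?G s j (x - cvec r) - ?G s j x * ?G r i (x - cvec s)))"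
  proof -
    have 1: "symbol r u x * symbol s v (x - cvec r)
      = (\<Sum>i\<in>UNIV. \<Sum>j\<in>UNIV. (u $ i * ?G r i x) * (v $ j * ?G s j (x - cvec r)))"
      unfolding symbol_def by (rule sum_product)
    have 2: "symbol s v x * symbol r u (x - cvec s)
      = (\<Sum>i\<in>UNIV. \<Sum>j\<in>UNIV. (u $ i * ?G r i (x - cvec s)) * (v $ j * ?G s j x))"
      unfolding symbol_def by (subst mult.commute) (rule sum_product)
    show ?thesis
      unfolding 1 2 sum_subtractf[symmetric] by (intro sum.cong refl) (simp add: right_diff_distrib mult_ac)
  qed
  also have "\<dots> = (\<Sum>i\<in>UNIV. \<Sum>j\<in>UNIV. (u $ i * of_int (s $ i)) * (v $ j * ?G (r + s) j x))
    - (\<Sum>i\<in>UNIV. \<Sum>j\<in>UNIV. (u $ i * ?G (r + s) i x) * (v $ j * of_int (r $ j)))"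
    unfolding basis sum_subtractf[symmetric] by (intro sum.cong refl) (simp add: right_diff_distrib mult_ac)
  also have "\<dots> = (u \<bullet>\<bullet> cvec s) * symbol (r + s) v x - (v \<bullet>\<bullet> cvec r) * symbol (r + s) u x"
    unfolding sum_product[symmetric] by (simp add: pairing_def symbol_def mult.commute)
  finally show "symbol r u x * symbol s v (x - cvec r) - symbol s v x * symbol r u (x - cvec s)
    = (u \<bullet>\<bullet> cvec s) * symbol (r + s) v x - (v \<bullet>\<bullet> cvec r) * symbol (r + s) u x" .
qed

lemma isomorphic_omega:
  assumes card: "1 < CARD('n)"
  obtains \<Lambda> :: "complex ^ 'n" and a where "\<And>i. \<Lambda> $ i \<noteq> 0"
    "witt_module_iso smul act (\<lambda>c f. const c * f) (omega_act \<Lambda> a)"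
proof -
  interpret witt_symbol symbol by (rule witt_symbol_symbol)
  obtain \<Lambda> :: "complex ^ 'n" and \<beta> where \<Lambda>: "\<And>i. \<Lambda> $ i \<noteq> 0"
    and form: "\<And>k u x. symbol k u x = (\<Prod>j\<in>UNIV. (\<Lambda> $ j) powi (k $ j)) * (u \<bullet>\<bullet> x - (u \<bullet>\<bullet> cvec k) * \<beta>)"
    by (rule witt_symbol_classification[OF card]) (rule that)
  have basis: "pact (witt_basis k i) p = omega_basis \<Lambda> (\<beta> - 1) k i p" for k i p
  proof -
    have "pact (witt_basis k i) 1 = const (\<Prod>j\<in>UNIV. (\<Lambda> $ j) powi (k $ j)) * (pvar i - const (of_int (k $ i) * \<beta>))"
    proof (rule peval_inject)
      show "peval (pact (witt_basis k i) 1) x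
        = peval (const (\<Prod>j\<in>UNIV. (\<Lambda> $ j) powi (k $ j)) * (pvar i - const (of_int (k $ i) * \<beta>))) x" for x
        unfolding symbol_axis[symmetric] form by simp
    qed
    then show ?thesis
      unfolding pact_shift[of k i p] omega_basis_def by (simp add: mult_ac)
  qed
  have act: "pact D p = omega_act \<Lambda> (\<beta> - 1) D p" if D: "D \<in> Witt" for D p
  proof -
    let ?c = "\<lambda>i k. Poly_Mapping.lookup (witt_coeff D i) k"
    let ?v = "cartan_act smul act p v0"
    have "pact D p = coord (act (\<lambda>f. \<Sum>i\<in>UNIV. \<Sum>k\<in>Poly_Mapping.keys (witt_coeff D i). const (?c i k) * witt_basis k i f) ?v)"
      unfolding pact_def by (subst Witt_expand_basis[OF D]) (rule refl)
    also have "\<dots> = (\<Sum>i\<in>UNIV. \<Sum>k\<in>Poly_Mapping.keys (witt_coeff D i). const (?c i k) * pact (witt_basis k i) p)"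
      by (simp add: act_sum_left Witt_sum Witt_scale witt_basis_in_Witt act_scale_left coord_sum coord_smul pact_def)
    finally show ?thesis unfolding basis omega_act_def .
  qed
  have "vector_space (\<lambda>c (f :: 'n mpoly). const c * f)"
    by unfold_locales (simp_all add: const_simps distrib_left distrib_right mult.assoc)
  then have "Vector_Spaces.linear smul (\<lambda>c f. const c * f) coord"
    using vector_space_axioms
    by (simp add: Vector_Spaces.linear_iff coord_add coord_smul)
  then have "witt_module_iso smul act (\<lambda>c f. const c * f) (omega_act \<Lambda> (\<beta> - 1))"
    unfolding witt_module_iso_def
    by (intro exI[of _ coord]) (simp add: coord_bij coord_act act)
  with \<Lambda> show ?thesis by (rule that)
qed

end

theorem theorem9:
  fixes smul :: "complex \<Rightarrow> 'm::ab_group_add \<Rightarrow> 'm"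
    and act :: "('n::finite laurent \<Rightarrow> 'n laurent) \<Rightarrow> 'm \<Rightarrow> 'm"
  assumes "1 < CARD('n)"
    and "witt_module smul act"
    and "free_module_of_rank (cartan_act smul act) 1"
  shows "\<exists>(\<Lambda> :: complex ^ 'n) a. (\<forall>i. \<Lambda> $ i \<noteq> 0) \<and>
           witt_module_iso smul act (\<lambda>c f. const c * f) (omega_act \<Lambda> a)"
proof -
  interpret witt_module smul act by fact
  interpret M: module "cartan_act smul act" by (rule module_cartan_act)
  obtain B where B: "card B = 1" "\<not> M.dependent B" "M.span B = UNIV"
    using assms(3) unfolding free_module_of_rank_def by blast
  then obtain v0 where v0: "B = {v0}" by (auto simp: card_1_singleton_iff)
  have "range (\<lambda>p. cartan_act smul act p v0) = UNIV"
    using B(3) unfolding v0 M.span_singleton .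
  moreover have "inj (\<lambda>p. cartan_act smul act p v0)"
  proof (rule injI)
    fix p q assume "cartan_act smul act p v0 = cartan_act smul act q v0"
    then have "cartan_act smul act (p - q) v0 = 0" by (simp add: M.scale_left_diff_distrib)
    then have "p - q = 0"
      using B(2) unfolding v0 M.dependent_explicit
      by (auto dest!: spec[of _ "{v0}"] spec[of _ "\<lambda>_. p - q"])
    then show "p = q" by simp
  qed
  ultimately interpret rank_one_witt_module smul act v0
    by unfold_locales (simp add: bij_def)
  show ?thesis using isomorphic_omega[OF assms(1)] by metis
qed

end
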